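(* (i) Let $g\ge 2$ be an integer and let $A\subseteq\mathbb{N}_0$ be a $\times g$-invariant set such that $A=A_\Sigma$ for some transitive sofic subshift $\Sigma\subseteq\{0,\dots,g-1\}^{\mathbb{N}_0}$. Then for every infinite arithmetic progression $P$, $\dim_{\mathrm M}(A\cap P)$ is either $0$ or $\dim_{\mathrm M}(A)$. (ii) The conclusion of (i) can fail if the subshift is only assumed to be transitive, and it can fail if the subshift is only assumed to be sofic. That is: there exist an integer $g\geq2$, a transitive subshift $\Sigma\subseteq\{0,\dots,g-1\}^{\mathbb{N}_0}$ and an infinite arithmetic progression $P$ for which it is not true that $\dim_{\mathrm M}(A_\Sigma\cap P)\in\{0,\dim_{\mathrm M}(A_\Sigma)\}$; and there exist an integer $g\geq 2$, a sofic subshift $\Sigma\subseteq\{0,\dots,g-1\}^{\mathbb{N}_0}$ and an infinite arithmetic progression $P$ for which it is not true that $\dim_{\mathrm M}(A_\Sigma\cap P)\in\{0,\dim_{\mathrm M}(A_\Sigma)\}$.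
   Context: $\mathbb{N}_0=\{0,1,2,\dots\}$. A set $A\subseteq\mathbb{N}_0$ is $\times g$-invariant if for every $n\in A$ with base-$g$ expansion $n=w_mg^m+\dots+w_1g+w_0$, $w_m\ne0$, both $w_{m-1}g^{m-1}+\dots+w_1g+w_0$ and $w_mg^{m-1}+\dots+w_2g+w_1$ belong to $A$. A subshift $\Sigma\subseteq\{0,\dots,g-1\}^{\mathbb{N}_0}$ is a non-empty closed (product topology) set with $\sigma(\Sigma)\subseteq\Sigma$, where $\sigma$ is the left shift $(x_n)_n\mapsto(x_{n+1})_n$. Its language $\mathcal{L}(\Sigma)$ is the set of finite words $w_0\cdots w_{n-1}$, $n\in\mathbb{N}_0$, for which there is $x\in\Sigma$ with $x_0=w_0,\dots,x_{n-1}=w_{n-1}$. $\Sigma$ is transitive if for all $u,v\in\mathcal{L}(\Sigma)$ there is $w\in\mathcal{L}(\Sigma)$ with $uwv\in\mathcal{L}(\Sigma)$. $\Sigma$ is sofic if there is a finite directed multigraph with labelled edges such that $\Sigma$ is the set of label sequences of infinite paths in the graph. For a word $w=w_0\cdots w_{n-1}$ put $(w)_g=w_0+w_1g+\dots+w_{n-1}g^{n-1}$, and let $A_\Sigma=\{(w)_g: w\in\mathcal{L}(\Sigma)\}$. The mass dimension is $\dim_{\mathrm M}(A)=\lim_{N\to\infty}\frac{\log|A\cap[0,N)|}{\log N}$ when this limit exists (it exists for every non-empty $\times g$-invariant set). The empty set is regarded as having mass dimension $0$. *)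

theory Defs
  imports "HOL-Analysis.Analysis" "Graph_Theory.Digraph"
begin

text \<open>
  For a single digit (\<open>m = 0\<close>) both truncations are the empty sum \<open>0\<close>; the number \<open>0\<close> itself
  has no expansion with a nonzero leading digit and imposes no condition.
\<close>
definition times_invariant :: "nat \<Rightarrow> nat set \<Rightarrow> bool" where
  "times_invariant g A \<longleftrightarrow>
    (\<forall>m w. (\<forall>i\<le>m. w i < g) \<and> w m \<noteq> 0 \<and> (\<Sum>i\<le>m. w i * g ^ i) \<in> A \<longrightarrow>
       (\<Sum>i<m. w i * g ^ i) \<in> A \<and> (\<Sum>i<m. w (Suc i) * g ^ i) \<in> A)"

definition left_shift :: "(nat \<Rightarrow> 'a) \<Rightarrow> nat \<Rightarrow> 'a" where
  "left_shift x = (\<lambda>n. x (Suc n))"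

text \<open>
  \<open>closedin\<close> also forces \<open>\<Sigma>\<close> to be contained in the underlying space of the product topology,
  i.e. in the set of all sequences over \<open>{..<g}\<close>.
\<close>
definition subshift :: "nat \<Rightarrow> (nat \<Rightarrow> nat) set \<Rightarrow> bool" where
  "subshift g \<Sigma> \<longleftrightarrow>
    \<Sigma> \<noteq> {} \<and>
    closedin (product_topology (\<lambda>_. discrete_topology {..<g}) UNIV) \<Sigma> \<and>
    left_shift ` \<Sigma> \<subseteq> \<Sigma>"

definition language :: "(nat \<Rightarrow> 'a) set \<Rightarrow> 'a list set" where
  "language \<Sigma> = {w. \<exists>x\<in>\<Sigma>. \<forall>i<length w. x i = w ! i}"

definition transitive_shift :: "(nat \<Rightarrow> 'a) set \<Rightarrow> bool" where
  "transitive_shift \<Sigma> \<longleftrightarrow>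
    (\<forall>u\<in>language \<Sigma>. \<forall>v\<in>language \<Sigma>. \<exists>w\<in>language \<Sigma>. u @ w @ v \<in> language \<Sigma>)"

text \<open>
  A finite directed multigraph is a \<open>fin_digraph\<close>, which admits loops and parallel arcs. Taking
  vertices and arcs in \<open>nat\<close> is no restriction, since the graph is finite.
\<close>
definition label_sequences :: "('v, 'e) pre_digraph \<Rightarrow> ('e \<Rightarrow> 'a) \<Rightarrow> (nat \<Rightarrow> 'a) set" where
  "label_sequences G lab =
    {(\<lambda>n. lab (e n)) | e. \<forall>n. e n \<in> arcs G \<and> head G (e n) = tail G (e (Suc n))}"

definition sofic :: "(nat \<Rightarrow> 'a) set \<Rightarrow> bool" where
  "sofic \<Sigma> \<longleftrightarrow>
    (\<exists>(G :: (nat, nat) pre_digraph) lab. fin_digraph G \<and> \<Sigma> = label_sequences G lab)"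

definition word_value :: "nat \<Rightarrow> nat list \<Rightarrow> nat" where
  "word_value g w = (\<Sum>i<length w. w ! i * g ^ i)"

definition shift_numbers :: "nat \<Rightarrow> (nat \<Rightarrow> nat) set \<Rightarrow> nat set" where
  "shift_numbers g \<Sigma> = word_value g ` language \<Sigma>"

text \<open>
  The mass dimension is a partial function, so it is rendered as a relation: the dimension of
  \<open>A\<close> exists and equals \<open>d\<close>. Such a \<open>d\<close> is unique by uniqueness of limits.
\<close>
definition has_mass_dimension :: "nat set \<Rightarrow> real \<Rightarrow> bool" where
  "has_mass_dimension A d \<longleftrightarrow>
    (if A = {} then d = 0
     else (\<lambda>N. ln (real (card (A \<inter> {..<N}))) / ln (real N)) \<longlonglongrightarrow> d)"

definition infinite_arith_prog :: "nat set \<Rightarrow> bool" where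
  "infinite_arith_prog P \<longleftrightarrow> (\<exists>a d. d > 0 \<and> P = {a + k * d | k. True})"

end

theory Submission
  imports Defs "HOL-Number_Theory.Residues" "HOL-Real_Asymp.Real_Asymp"
begin

text \<open>
  The number of elements of \<open>A\<^sub>\<Sigma>\<close> below \<open>g ^ n\<close> agrees up to a factor \<open>n + 1\<close> with the number of words of
  length \<open>n\<close>, which is submultiplicative; hence the mass dimension of \<open>A\<^sub>\<Sigma>\<close> is the exponential growth rate
  of the language divided by \<open>ln g\<close>.

  Let \<open>\<Sigma>\<close> be transitive and sofic and suppose that \<open>A\<^sub>\<Sigma> \<inter> P\<close> is infinite. Then some long word \<open>w\<close>
  has its value in \<open>P\<close>; extend it to \<open>p = w t s\<close> with \<open>s\<close> synchronizing. Every word \<open>p r v\<close> can be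
  continued by some \<open>z\<close> to a word whose value lies in \<open>P\<close>: return to \<open>w t s\<close> and repeat the resulting loop
  until its contribution vanishes modulo the step of \<open>P\<close>. The choices of \<open>r\<close> and \<open>z\<close> depend only on
  follower sets, predecessor sets and residues, of which there are finitely many. So \<open>r\<close> and \<open>z\<close> have bounded
  length, and \<open>A\<^sub>\<Sigma> \<inter> P\<close> has the same growth rate as \<open>A\<^sub>\<Sigma>\<close>.

  Both counterexamples use \<open>g = 10\<close> and the multiples of 10, so that the relevant words are those starting
  with \<open>0\<close>: without transitivity these can be confined to binary words, and without the sofic condition
  a digit \<open>0\<close> can force at least half of the digits in each window following it to be \<open>1\<close>.
\<close>

section \<open>Growth rates and mass dimension\<close>

lemma subadditive_mult_le:
  fixes u :: "nat \<Rightarrow> real"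
  assumes sub: "\<And>m n. u (m + n) \<le> u m + u n" and u0: "u 0 \<le> 0"
  shows "u (q * m) \<le> real q * u m"
proof (induction q)
  case (Suc q)
  have "u (Suc q * m) \<le> u m + u (q * m)"
    using sub[of m "q * m"] by simp
  then show ?case
    using Suc by (simp add: algebra_simps)
qed (simp add: u0)

text \<open>Fekete's lemma: with \<open>m\<close> fixed and nearly optimal, write
  \<open>n = q * m + r\<close> with \<open>r < m\<close>. The \<open>q\<close> blocks contribute at
  most \<open>(n / m) * u m\<close>, and the remainder is bounded independently of
  \<open>n\<close>.\<close>

lemma subadditive_tendsto_Inf:
  fixes u :: "nat \<Rightarrow> real"
  assumes sub: "\<And>m n. u (m + n) \<le> u m + u n" and u0: "u 0 \<le> 0" and nonneg: "\<And>n. u n \<ge> 0"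
  shows "(\<lambda>n. u n / real n) \<longlonglongrightarrow> (INF n\<in>{1..}. u n / real n)"
proof -
  \<comment> \<open>Index 0 is left out of the infimum: \<open>u 0 / real 0\<close> is 0 by the
    convention on division and would make it 0.\<close>
  define l where "l = (INF n\<in>{1..}. u n / real n)"
  have bdd: "bdd_below ((\<lambda>n. u n / real n) ` {1..})"
    by (rule bdd_belowI[of _ 0]) (use nonneg in auto)
  have lower: "l \<le> u n / real n" if "n \<ge> 1" for n
    unfolding l_def by (rule cINF_lower[OF bdd]) (use that in auto)
  have upper: "eventually (\<lambda>n. u n / real n < l + e) sequentially" if "e > 0" for e
  proof -
    have "\<exists>m\<in>{1..}. u m / real m < l + e / 2"
      using \<open>e > 0\<close> cINF_less_iff[OF _ bdd, of "l + e / 2"] by (auto simp: l_def)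
    then obtain m where m: "m \<ge> 1" "u m / real m < l + e / 2" by auto
    define C where "C = Max (u ` {..<m})"
    have C: "u r \<le> C" if "r < m" for r
      unfolding C_def by (rule Max_ge) (use that in auto)
    have "(\<lambda>n. C / real n) \<longlonglongrightarrow> 0"
      by real_asymp
    then have "eventually (\<lambda>n. C / real n < e / 2) sequentially"
      using \<open>e > 0\<close> by (rule order_tendstoD(2)[OF _ half_gt_zero])
    then show ?thesis
      using eventually_ge_at_top[of 1]
    proof eventually_elim
      case (elim n)
      define q where "q = n div m"
      have "u n \<le> u (q * m) + u (n mod m)"
        using sub[of "q * m" "n mod m"] by (simp add: q_def)
      also have "\<dots> \<le> real q * u m + C"
        using subadditive_mult_le[of u q m, OF sub u0] C[of "n mod m"] m by auto
      also have "real q * u m \<le> (real n / real m) * u m"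
      proof (rule mult_right_mono[OF _ nonneg])
        have "real (q * m) \<le> real n"
          unfolding of_nat_le_iff q_def by simp
        then show "real q \<le> real n / real m"
          using m by (simp add: field_simps)
      qed
      finally have "u n \<le> (real n / real m) * u m + C" by simp
      then have "u n / real n \<le> u m / real m + C / real n"
        using elim(2) m by (simp add: field_simps)
      then show ?case
        using m elim by linarith
    qed
  qed
  have "(\<lambda>n. u n / real n) \<longlonglongrightarrow> l"
  proof (rule order_tendstoI)
    fix a assume "a < l"
    show "eventually (\<lambda>n. a < u n / real n) sequentially"
      using eventually_ge_at_top[of 1]
      by eventually_elim (use lower \<open>a < l\<close> in fastforce)
  next
    fix a assume "l < a"
    then show "eventually (\<lambda>n. u n / real n < a) sequentially"
      using upper[of "a - l"] by simp
  qed
  then show ?thesis by (simp add: l_def)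
qed

text \<open>Zero causes no exception, because \<open>ln 0 = 0\<close> and the logarithm of a
  positive natural number is nonnegative.\<close>

lemma ln_real_mono_nat: "m \<le> n \<Longrightarrow> ln (real m) \<le> ln (real n)"
  by (cases "m = 0"; cases "n = 0") auto

section \<open>Mass dimension read off along powers of the base\<close>

text \<open>The counting function is monotone and \<open>ln N\<close> changes by at most
  \<open>ln g\<close> between consecutive powers of \<open>g\<close>, so the powers determine the
  limit along all \<open>N\<close>.\<close>

lemma has_mass_dimension_powersI:
  assumes g: "g \<ge> 2" and ne: "A \<noteq> {}"
    and lim: "(\<lambda>n. ln (real (card (A \<inter> {..<g ^ n}))) / real n) \<longlonglongrightarrow> h"
  shows "has_mass_dimension A (h / ln (real g))"
proof -
  define f where "f N = ln (real (card (A \<inter> {..<N})))" for N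
  note limF = lim[folded f_def]
  have f_mono: "f M \<le> f N" if "M \<le> N" for M N
    unfolding f_def by (intro ln_real_mono_nat card_mono) (use that in auto)
  have f_nonneg: "f N \<ge> 0" for N
    using f_mono[of 0 N] by (simp add: f_def)
  have lg: "ln (real g) > 0" using g by simp
  \<comment> \<open>\<open>k N\<close> will be the integer part of the base-\<open>g\<close>
    logarithm of \<open>N\<close>.\<close>
  have "\<forall>N. \<exists>k. N \<ge> 1 \<longrightarrow> g ^ k \<le> N \<and> N < g ^ (k + 1)"
    using ex_power_ivl1[OF g] by blast
  then obtain k where "\<forall>N. N \<ge> 1 \<longrightarrow> g ^ k N \<le> N \<and> N < g ^ (k N + 1)" by metis
  then have k: "g ^ k N \<le> N" "N < g ^ (k N + 1)" if "N \<ge> 1" for N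
    using that by blast+
  have ktop: "filterlim k at_top sequentially"
    unfolding filterlim_at_top
  proof
    fix Z
    show "eventually (\<lambda>N. Z \<le> k N) sequentially"
      using eventually_ge_at_top[of "g ^ Z"]
    proof eventually_elim
      case (elim N)
      then have "g ^ Z < g ^ (k N + 1)"
        using k(2)[of N] g one_le_power[of g Z] by linarith
      then have "Z < k N + 1"
        using power_less_imp_less_exp[of g Z "k N + 1"] g by linarith
      then show ?case by simp
    qed
  qed
  have lo: "(\<lambda>n. f (g ^ n) / (real (n + 1) * ln (real g))) \<longlonglongrightarrow> h / ln (real g)"
  proof -
    have "(\<lambda>n. (f (g ^ n) / real n) * (real n / real (n + 1)) / ln (real g)) \<longlonglongrightarrow> h * 1 / ln (real g)"
      by (intro tendsto_divide tendsto_mult tendsto_const limF) (use lg in auto, real_asymp)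
    then have "(\<lambda>n. (f (g ^ n) / real n) * (real n / real (n + 1)) / ln (real g)) \<longlonglongrightarrow> h / ln (real g)"
      by simp
    then show ?thesis
    proof (rule Lim_transform_eventually)
      show "eventually (\<lambda>n. (f (g ^ n) / real n) * (real n / real (n + 1)) / ln (real g) = f (g ^ n) / (real (n + 1) * ln (real g))) sequentially"
        using eventually_gt_at_top[of 0] by eventually_elim simp
    qed
  qed
  have hi: "(\<lambda>n. f (g ^ (n + 1)) / (real n * ln (real g))) \<longlonglongrightarrow> h / ln (real g)"
  proof -
    have "(\<lambda>n. (f (g ^ (n + 1)) / real (n + 1)) * (real (n + 1) / real n) / ln (real g)) \<longlonglongrightarrow> h * 1 / ln (real g)"
      by (intro tendsto_divide tendsto_mult tendsto_const LIMSEQ_ignore_initial_segment[OF limF, of 1]) (use lg in auto, real_asymp)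
    then have "(\<lambda>n. (f (g ^ (n + 1)) / real (n + 1)) * (real (n + 1) / real n) / ln (real g)) \<longlonglongrightarrow> h / ln (real g)"
      by simp
    then show ?thesis
    proof (rule Lim_transform_eventually)
      show "eventually (\<lambda>n. (f (g ^ (n + 1)) / real (n + 1)) * (real (n + 1) / real n) / ln (real g) = f (g ^ (n + 1)) / (real n * ln (real g))) sequentially"
        using eventually_gt_at_top[of 0] by eventually_elim simp
    qed
  qed
  have "(\<lambda>N. f N / ln (real N)) \<longlonglongrightarrow> h / ln (real g)"
  proof (rule tendsto_sandwich[OF _ _ filterlim_compose[OF lo ktop] filterlim_compose[OF hi ktop]])
    show "eventually (\<lambda>N. f (g ^ k N) / (real (k N + 1) * ln (real g)) \<le> f N / ln (real N)) sequentially"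
      using eventually_ge_at_top[of 2]
    proof eventually_elim
      case (elim N)
      have "ln (real N) \<le> ln (real (g ^ (k N + 1)))"
        by (rule ln_real_mono_nat) (use k[of N] elim in auto)
      then have "ln (real N) \<le> real (k N + 1) * ln (real g)"
        using g by (simp add: ln_realpow algebra_simps del: power_Suc)
      then show ?case
        using f_mono[OF k(1)[of N]] f_nonneg elim by (intro frac_le) auto
    qed
    show "eventually (\<lambda>N. f N / ln (real N) \<le> f (g ^ (k N + 1)) / (real (k N) * ln (real g))) sequentially"
      \<comment> \<open>From \<open>N \<ge> g\<close> on, \<open>k N\<close> is nonzero, so the
        denominator of the upper bound is positive.\<close>
      using eventually_ge_at_top[of g]
    proof eventually_elim
      case (elim N)
      then have N: "N \<ge> 1" "N \<ge> 2" using g by auto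
      have "k N \<noteq> 0"
        using k(2)[OF N(1)] elim by (intro notI) simp
      moreover have "ln (real (g ^ k N)) \<le> ln (real N)"
        by (rule ln_real_mono_nat) (use k[of N] N in auto)
      then have "real (k N) * ln (real g) \<le> ln (real N)"
        using g by (simp add: ln_realpow)
      ultimately show ?case
        using f_mono[of N "g ^ (k N + 1)"] k(2)[OF N(1)] f_nonneg lg by (intro frac_le) auto
    qed
  qed
  then show ?thesis
    using ne by (simp add: has_mass_dimension_def f_def)
qed

text \<open>Passing to the subsequence of powers of \<open>g\<close>. This direction serves to
  refute candidate values of the dimension.\<close>

lemma has_mass_dimension_powersD:
  assumes g: "g \<ge> 2" and ne: "A \<noteq> {}" and dim: "has_mass_dimension A d"
  shows "(\<lambda>n. ln (real (card (A \<inter> {..<g ^ n}))) / real n) \<longlonglongrightarrow> d * ln (real g)"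
proof -
  have sub: "filterlim (\<lambda>n. g ^ n) at_top sequentially"
    using g by (intro filterlim_subseq) (simp add: strict_mono_def)
  have "(\<lambda>N. ln (real (card (A \<inter> {..<N}))) / ln (real N)) \<longlonglongrightarrow> d"
    using dim ne by (simp add: has_mass_dimension_def)
  from filterlim_compose[OF this sub]
  have "(\<lambda>n. ln (real (card (A \<inter> {..<g ^ n}))) / ln (real (g ^ n))) \<longlonglongrightarrow> d" .
  then have "(\<lambda>n. ln (real (card (A \<inter> {..<g ^ n}))) / ln (real (g ^ n)) * ln (real g)) \<longlonglongrightarrow> d * ln (real g)"
    by (intro tendsto_intros)
  then show ?thesis
    using g by (simp add: ln_realpow)
qed

lemma has_mass_dimension_finite:
  assumes "finite A"
  shows "has_mass_dimension A 0"
proof (cases "A = {}")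
  case False
  have "(\<lambda>N. ln (real (card (A \<inter> {..<N}))) / ln (real N)) \<longlonglongrightarrow> 0"
  proof (rule Lim_transform_eventually)
    show "(\<lambda>N. ln (real (card A)) / ln (real N)) \<longlonglongrightarrow> 0"
      by real_asymp
    show "eventually (\<lambda>N. ln (real (card A)) / ln (real N) = ln (real (card (A \<inter> {..<N}))) / ln (real N)) sequentially"
      using eventually_gt_at_top[of "Max A"]
    proof eventually_elim
      case (elim N)
      then have "A \<inter> {..<N} = A"
        using Max_ge[OF assms] by fastforce
      then show ?case by simp
    qed
  qed
  with False show ?thesis by (simp add: has_mass_dimension_def)
qed (simp add: has_mass_dimension_def)

text \<open>A constant factor, a bounded shift of the index and a linear factor change the logarithm
  by too little to survive division by \<open>n\<close>. Here \<open>a\<close> stands for word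
  counts and \<open>b\<close> for counts of numbers below \<open>g ^ n\<close>.\<close>

lemma growth_rate_sandwich:
  fixes a b :: "nat \<Rightarrow> nat"
  assumes lim: "(\<lambda>n. ln (real (a n)) / real n) \<longlonglongrightarrow> h"
    and pos: "\<And>n. a n > 0"
    and low: "\<And>n. a n \<le> D * b (n + C)"
    and up: "\<And>n. b n \<le> (n + 1) * a n"
  shows "(\<lambda>n. ln (real (b n)) / real n) \<longlonglongrightarrow> h"
proof (rule LIMSEQ_offset[where k = C], rule tendsto_sandwich)
  have D: "D > 0" and b: "b (n + C) > 0" for n
    using low[of n] pos[of n] by (auto intro: ccontr)
  show "eventually (\<lambda>n. (ln (real (a n)) - ln (real D)) / real (n + C) \<le> ln (real (b (n + C))) / real (n + C)) sequentially"
  proof (intro always_eventually allI divide_right_mono)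
    fix n
    have "ln (real (a n)) \<le> ln (real D) + ln (real (b (n + C)))"
      using ln_real_mono_nat[OF low[of n]] D b[of n] by (simp add: ln_mult)
    then show "ln (real (a n)) - ln (real D) \<le> ln (real (b (n + C)))" by simp
  qed auto
  show "eventually (\<lambda>n. ln (real (b (n + C))) / real (n + C) \<le>
      (ln (real (n + C + 1)) + ln (real (a (n + C)))) / real (n + C)) sequentially"
  proof (intro always_eventually allI divide_right_mono)
    fix n
    show "ln (real (b (n + C))) \<le> ln (real (n + C + 1)) + ln (real (a (n + C)))"
      using ln_real_mono_nat[OF up[of "n + C"]] pos[of "n + C"]
      by (simp only: of_nat_mult) (simp add: ln_mult)
  qed auto
  have "(\<lambda>n. ln (real (a n)) / real n * (real n / real (n + C)) - ln (real D) / real (n + C)) \<longlonglongrightarrow> h * 1 - 0"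
    by (intro tendsto_diff tendsto_mult lim) real_asymp+
  then have "(\<lambda>n. ln (real (a n)) / real n * (real n / real (n + C)) - ln (real D) / real (n + C)) \<longlonglongrightarrow> h"
    by simp
  then show "(\<lambda>n. (ln (real (a n)) - ln (real D)) / real (n + C)) \<longlonglongrightarrow> h"
  proof (rule Lim_transform_eventually)
    show "eventually (\<lambda>n. ln (real (a n)) / real n * (real n / real (n + C)) - ln (real D) / real (n + C)
        = (ln (real (a n)) - ln (real D)) / real (n + C)) sequentially"
      using eventually_gt_at_top[of 0]
      by eventually_elim (simp add: diff_divide_distrib)
  qed
  have "(\<lambda>n. ln (real (n + C + 1)) / real (n + C) + ln (real (a (n + C))) / real (n + C)) \<longlonglongrightarrow> 0 + h"
    by (intro tendsto_add LIMSEQ_ignore_initial_segment[OF lim, of C]) real_asymp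
  then show "(\<lambda>n. (ln (real (n + C + 1)) + ln (real (a (n + C)))) / real (n + C)) \<longlonglongrightarrow> h"
    by (simp add: add_divide_distrib)
qed

section \<open>Words and their values\<close>

lemma word_value_Nil [simp]: "word_value g [] = 0"
  by (simp add: word_value_def)

lemma word_value_Cons [simp]: "word_value g (a # w) = a + g * word_value g w"
  unfolding word_value_def length_Cons sum.lessThan_Suc_shift
  by (simp add: sum_distrib_left mult_ac)

lemma word_value_append: "word_value g (u @ v) = word_value g u + g ^ length u * word_value g v"
  by (induction u) (simp_all add: algebra_simps)

lemma word_value_less:
  assumes "set w \<subseteq> {..<g}"
  shows "word_value g w < g ^ length w"
  using assms
proof (induction w)
  case (Cons a w)
  then have "word_value g w + 1 \<le> g ^ length w" "a < g" by auto
  then have "a + g * word_value g w < g * (word_value g w + 1)" by simp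
  also have "\<dots> \<le> g * g ^ length w"
    using \<open>word_value g w + 1 \<le> g ^ length w\<close> by (rule mult_le_mono2)
  finally show ?case by simp
qed simp

lemma word_value_append_mod:
  assumes "set u \<subseteq> {..<g}"
  shows "word_value g (u @ v) mod g ^ length u = word_value g u"
  using word_value_less[OF assms] by (simp add: word_value_append)

lemma word_value_eq_iff:
  assumes "length u = length v" "set u \<subseteq> {..<g}" "set v \<subseteq> {..<g}"
  shows "word_value g u = word_value g v \<longleftrightarrow> u = v"
proof
  show "word_value g u = word_value g v \<Longrightarrow> u = v"
    using assms
  proof (induction u v rule: list_induct2)
    case (Cons a u b v)
    have "(a + g * word_value g u) mod g = (b + g * word_value g v) mod g"
      using Cons.prems(1) by simp
    then have "a = b" using Cons.prems(2,3) by simp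
    moreover have "g > 0" using Cons.prems(2) by auto
    ultimately have "word_value g u = word_value g v"
      using Cons.prems(1) by simp
    then show ?case
      using Cons.IH Cons.prems(2,3) \<open>a = b\<close> by simp
  qed simp
qed (rule arg_cong)

text \<open>The first letters are the low-order digits, so a prefix of known length can be recovered
  from the value whatever follows it. The continuations \<open>x\<close> and \<open>y\<close> may
  therefore differ.\<close>

lemma append_eq_if_word_value_eq:
  assumes val: "word_value g (u @ x) = word_value g (v @ y)" and len: "length u = length v"
    and u: "set u \<subseteq> {..<g}" and v: "set v \<subseteq> {..<g}"
  shows "u = v"
proof -
  have "word_value g u = word_value g v"
    unfolding word_value_append_mod[OF u, of x, symmetric] word_value_append_mod[OF v, of y, symmetric]
    by (simp only: val len)
  then show ?thesis
    using word_value_eq_iff[OF len u v] by simp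
qed

section \<open>Words of a given length and their number\<close>

definition words :: "(nat \<Rightarrow> 'a) set \<Rightarrow> nat \<Rightarrow> 'a list set" where
  "words \<Sigma> n = {w \<in> language \<Sigma>. length w = n}"

lemma map_upt_eq_iff: "map x [0..<n] = w \<longleftrightarrow> length w = n \<and> (\<forall>i<n. x i = w ! i)"
  by (auto simp: list_eq_iff_nth_eq)

lemma words_eq: "words \<Sigma> n = (\<lambda>x. map x [0..<n]) ` \<Sigma>"
proof (intro equalityI subsetI)
  fix w assume "w \<in> words \<Sigma> n"
  then obtain x where "x \<in> \<Sigma>" "length w = n" "\<forall>i<n. x i = w ! i"
    unfolding words_def language_def by blast
  then show "w \<in> (\<lambda>x. map x [0..<n]) ` \<Sigma>"
    using map_upt_eq_iff[of x n w] by (intro image_eqI[of _ _ x]) simp_all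
qed (auto simp: words_def language_def)

lemma languageE:
  assumes "w \<in> language \<Sigma>"
  obtains x where "x \<in> \<Sigma>" "\<And>i. i < length w \<Longrightarrow> x i = w ! i"
  using assms unfolding language_def by blast

lemma languageI: "x \<in> \<Sigma> \<Longrightarrow> (\<And>i. i < length w \<Longrightarrow> x i = w ! i) \<Longrightarrow> w \<in> language \<Sigma>"
  unfolding language_def by blast

lemma language_appendD1:
  assumes "u @ v \<in> language \<Sigma>"
  shows "u \<in> language \<Sigma>"
  using assms
proof (rule languageE)
  fix x assume "x \<in> \<Sigma>" and x: "\<And>i. i < length (u @ v) \<Longrightarrow> x i = (u @ v) ! i"
  show ?thesis
  proof (rule languageI[OF \<open>x \<in> \<Sigma>\<close>])
    show "x i = u ! i" if "i < length u" for i
      using x[of i] that by (simp add: nth_append)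
  qed
qed

locale shift_space =
  fixes g :: nat and \<Sigma> :: "(nat \<Rightarrow> nat) set"
  assumes g_ge_2: "g \<ge> 2" and subshift: "subshift g \<Sigma>"
begin

lemma digit_less: "x \<in> \<Sigma> \<Longrightarrow> x i < g"
proof -
  assume "x \<in> \<Sigma>"
  moreover have "\<Sigma> \<subseteq> PiE UNIV (\<lambda>_. {..<g})"
    using closedin_subset[of "product_topology (\<lambda>_. discrete_topology {..<g}) UNIV" \<Sigma>] subshift
    by (simp add: subshift_def)
  ultimately show ?thesis by (auto simp: PiE_iff)
qed

lemma ne: "\<Sigma> \<noteq> {}"
  using subshift by (simp add: subshift_def)

lemma shift_mem: "x \<in> \<Sigma> \<Longrightarrow> (\<lambda>n. x (n + k)) \<in> \<Sigma>"
proof (induction k)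
  case (Suc k)
  then have "left_shift (\<lambda>n. x (n + k)) \<in> \<Sigma>"
    using subshift unfolding subshift_def by blast
  then show ?case by (simp add: left_shift_def)
qed simp

lemma language_digits: "w \<in> language \<Sigma> \<Longrightarrow> set w \<subseteq> {..<g}"
  by (metis languageE digit_less in_set_conv_nth lessThan_iff subsetI)

lemma language_appendD2:
  assumes "u @ v \<in> language \<Sigma>"
  shows "v \<in> language \<Sigma>"
  using assms
proof (rule languageE)
  fix x assume "x \<in> \<Sigma>" and x: "\<And>i. i < length (u @ v) \<Longrightarrow> x i = (u @ v) ! i"
  show ?thesis
  proof (rule languageI[OF shift_mem[OF \<open>x \<in> \<Sigma>\<close>]])
    show "x (i + length u) = v ! i" if "i < length v" for i
      using x[of "i + length u"] that by (simp add: nth_append)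
  qed
qed

lemma words_subset: "words \<Sigma> n \<subseteq> {w. set w \<subseteq> {..<g} \<and> length w = n}"
  using language_digits unfolding words_def by blast

lemma finite_words [simp]: "finite (words \<Sigma> n)"
  by (rule finite_subset[OF words_subset finite_lists_length_eq]) simp

lemma words_ne: "words \<Sigma> n \<noteq> {}"
  using ne by (simp add: words_eq)

lemma card_words_pos: "card (words \<Sigma> n) > 0"
  using words_ne finite_words by (simp add: card_gt_0_iff)

text \<open>Truncation maps the longer words onto the shorter ones, since every short word is a
  prefix of a point.\<close>

lemma card_words_mono: "m \<le> n \<Longrightarrow> card (words \<Sigma> m) \<le> card (words \<Sigma> n)"
proof -
  assume "m \<le> n"
  then have "words \<Sigma> m = take m ` words \<Sigma> n"
    by (auto simp: words_eq image_image take_map)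
  then show ?thesis
    using card_image_le[OF finite_words] by simp
qed

text \<open>Cutting a word after \<open>m\<close> letters leaves two words of the language, which
  determine it.\<close>

lemma card_words_add: "card (words \<Sigma> (m + n)) \<le> card (words \<Sigma> m) * card (words \<Sigma> n)"
proof -
  have "words \<Sigma> (m + n) \<subseteq> (\<lambda>(u, v). u @ v) ` (words \<Sigma> m \<times> words \<Sigma> n)"
  proof
    fix w assume "w \<in> words \<Sigma> (m + n)"
    then have w: "w \<in> language \<Sigma>" "length w = m + n" by (auto simp: words_def)
    have "take m w \<in> language \<Sigma>" "drop m w \<in> language \<Sigma>"
      using w(1) language_appendD1[of "take m w" "drop m w"] language_appendD2[of "take m w" "drop m w"]
      by simp_all
    then have "(take m w, drop m w) \<in> words \<Sigma> m \<times> words \<Sigma> n"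
      using w(2) by (simp add: words_def)
    then show "w \<in> (\<lambda>(u, v). u @ v) ` (words \<Sigma> m \<times> words \<Sigma> n)"
      by (rule rev_image_eqI) simp
  qed
  then have "card (words \<Sigma> (m + n)) \<le> card (words \<Sigma> m \<times> words \<Sigma> n)"
    by (rule surj_card_le[rotated]) simp
  then show ?thesis by (simp add: card_cartesian_product)
qed

text \<open>The limit is the topological entropy of the shift; submultiplicativity of the word
  counts makes their logarithms subadditive.\<close>

lemma growth_rate_exists:
  obtains h where "(\<lambda>n. ln (real (card (words \<Sigma> n))) / real n) \<longlonglongrightarrow> h"
proof (rule that[OF subadditive_tendsto_Inf])
  fix m n
  have "ln (real (card (words \<Sigma> (m + n)))) \<le> ln (real (card (words \<Sigma> m) * card (words \<Sigma> n)))"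
    by (rule ln_real_mono_nat[OF card_words_add])
  also have "\<dots> = ln (real (card (words \<Sigma> m))) + ln (real (card (words \<Sigma> n)))"
    using words_ne by (simp add: ln_mult)
  finally show "ln (real (card (words \<Sigma> (m + n)))) \<le> ln (real (card (words \<Sigma> m))) + ln (real (card (words \<Sigma> n)))" .
next
  have "words \<Sigma> 0 = {[]}" using ne by (auto simp: words_eq)
  then show "ln (real (card (words \<Sigma> 0))) \<le> 0" by simp
next
  show "ln (real (card (words \<Sigma> n))) \<ge> 0" for n
    using card_words_pos[of n] by simp
qed

text \<open>A word longer than \<open>n\<close> with value below \<open>g ^ n\<close> has only zeros
  after its first \<open>n\<close> letters, so its prefix of length \<open>n\<close> has the same
  value.\<close>

lemma shift_numbers_below_power:
  "shift_numbers g \<Sigma> \<inter> {..<g ^ n} = (\<Union>m\<le>n. word_value g ` words \<Sigma> m)"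
proof (intro equalityI subsetI)
  fix a assume "a \<in> shift_numbers g \<Sigma> \<inter> {..<g ^ n}"
  then obtain w where w: "w \<in> language \<Sigma>" "a = word_value g w" "a < g ^ n"
    by (auto simp: shift_numbers_def)
  show "a \<in> (\<Union>m\<le>n. word_value g ` words \<Sigma> m)"
  proof (cases "length w \<le> n")
    case True
    with w show ?thesis by (auto simp: words_def)
  next
    case False
    have t: "take n w \<in> language \<Sigma>"
      using w(1) language_appendD1[of "take n w" "drop n w"] by simp
    have "a = a mod g ^ n" using w(3) by simp
    also have "\<dots> = word_value g (take n w)"
      using word_value_append_mod[OF language_digits[OF t], of "drop n w"] False w(2) by (simp add: min_def)
    finally show ?thesis
      using t False by (auto simp: words_def)
  qed
next
  fix a assume "a \<in> (\<Union>m\<le>n. word_value g ` words \<Sigma> m)"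
  then obtain w where w: "w \<in> language \<Sigma>" "length w \<le> n" "a = word_value g w"
    by (auto simp: words_def)
  have "word_value g w < g ^ length w"
    by (rule word_value_less[OF language_digits[OF w(1)]])
  also have "\<dots> \<le> g ^ n" using w(2) g_ge_2 by (intro power_increasing) auto
  finally show "a \<in> shift_numbers g \<Sigma> \<inter> {..<g ^ n}"
    using w by (auto simp: shift_numbers_def)
qed

lemma inj_on_word_value_words: "inj_on (word_value g) (words \<Sigma> n)"
  by (auto simp: inj_on_def words_def word_value_eq_iff language_digits)

lemma card_shift_numbers_lower: "card (words \<Sigma> n) \<le> card (shift_numbers g \<Sigma> \<inter> {..<g ^ n})"
proof -
  have "card (words \<Sigma> n) = card (word_value g ` words \<Sigma> n)"
    by (simp add: card_image inj_on_word_value_words)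
  also have "\<dots> \<le> card (shift_numbers g \<Sigma> \<inter> {..<g ^ n})"
    by (rule card_mono) (auto simp: shift_numbers_below_power)
  finally show ?thesis .
qed

text \<open>Each of the \<open>n + 1\<close> possible lengths contributes at most as many numbers as
  there are words of length \<open>n\<close>.\<close>

lemma card_shift_numbers_upper: "card (shift_numbers g \<Sigma> \<inter> {..<g ^ n}) \<le> (n + 1) * card (words \<Sigma> n)"
proof -
  have "card (shift_numbers g \<Sigma> \<inter> {..<g ^ n}) \<le> (\<Sum>m\<le>n. card (word_value g ` words \<Sigma> m))"
    unfolding shift_numbers_below_power by (rule card_UN_le) simp
  also have "\<dots> \<le> (\<Sum>m\<le>n. card (words \<Sigma> n))"
    by (rule sum_mono) (rule order_trans[OF card_image_le card_words_mono], auto)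
  finally show ?thesis by simp
qed

lemma zero_mem_shift_numbers: "0 \<in> shift_numbers g \<Sigma>"
  using ne by (auto simp: shift_numbers_def language_def intro!: image_eqI[of _ _ "[]"])

lemma has_mass_dimension_shift_numbers:
  assumes "(\<lambda>n. ln (real (card (words \<Sigma> n))) / real n) \<longlonglongrightarrow> h"
  shows "has_mass_dimension (shift_numbers g \<Sigma>) (h / ln (real g))"
proof (rule has_mass_dimension_powersI[OF g_ge_2])
  show "shift_numbers g \<Sigma> \<noteq> {}" using zero_mem_shift_numbers by auto
  show "(\<lambda>n. ln (real (card (shift_numbers g \<Sigma> \<inter> {..<g ^ n}))) / real n) \<longlonglongrightarrow> h"
    by (rule growth_rate_sandwich[OF assms card_words_pos, where C = 0 and D = 1])
      (use card_shift_numbers_lower card_shift_numbers_upper in simp_all)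
qed

end

section \<open>Transitive sofic shifts\<close>

definition label_path :: "('v, 'e) pre_digraph \<Rightarrow> (nat \<Rightarrow> 'e) \<Rightarrow> bool" where
  "label_path G e \<longleftrightarrow> (\<forall>n. e n \<in> arcs G \<and> head G (e n) = tail G (e (Suc n)))"

text \<open>Only vertices from which an infinite path continues are collected, to match a language
  defined by infinite sequences. The tail of the next arc, rather than the head of the last one,
  also makes sense for the empty word.\<close>

definition end_states :: "('v, 'e) pre_digraph \<Rightarrow> ('e \<Rightarrow> 'a) \<Rightarrow> 'a list \<Rightarrow> 'v set" where
  "end_states G lab u =
    {tail G (e (length u)) | e. label_path G e \<and> (\<forall>i<length u. lab (e i) = u ! i)}"

definition start_states :: "('v, 'e) pre_digraph \<Rightarrow> ('e \<Rightarrow> 'a) \<Rightarrow> 'a list \<Rightarrow> 'v set" where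
  "start_states G lab v =
    {tail G (e 0) | e. label_path G e \<and> (\<forall>i<length v. lab (e i) = v ! i)}"

text \<open>A path reading \<open>u\<close> and a path reading \<open>v\<close> can be glued at a
  common vertex, and a path reading both words passes through such a vertex.\<close>

lemma append_mem_language_label_sequences:
  "u @ v \<in> language (label_sequences G lab) \<longleftrightarrow> end_states G lab u \<inter> start_states G lab v \<noteq> {}"
proof
  assume "u @ v \<in> language (label_sequences G lab)"
  then obtain x where "x \<in> label_sequences G lab" and x': "\<forall>i<length (u @ v). x i = (u @ v) ! i"
    unfolding language_def by blast
  then obtain e where e: "label_path G e" "x = (\<lambda>n. lab (e n))"
    by (auto simp: label_sequences_def label_path_def)
  have x: "x i = (u @ v) ! i" if "i < length (u @ v)" for i
    using x' that by blast
  have "tail G (e (length u)) \<in> end_states G lab u"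
  proof -
    have "lab (e i) = u ! i" if "i < length u" for i
      using x[of i] that e(2) by (simp add: nth_append)
    then show ?thesis
      using e(1) unfolding end_states_def by blast
  qed
  moreover have "tail G (e (length u)) \<in> start_states G lab v"
  proof -
    define e' where "e' n = e (length u + n)" for n
    have "label_path G e'"
      using e(1) by (simp add: label_path_def e'_def)
    moreover have "lab (e' i) = v ! i" if "i < length v" for i
      using x[of "length u + i"] that e(2) by (simp add: nth_append e'_def)
    moreover have "tail G (e (length u)) = tail G (e' 0)"
      by (simp add: e'_def)
    ultimately show ?thesis
      unfolding start_states_def by blast
  qed
  ultimately show "end_states G lab u \<inter> start_states G lab v \<noteq> {}" by blast
next
  assume "end_states G lab u \<inter> start_states G lab v \<noteq> {}"
  then obtain q where "q \<in> end_states G lab u" "q \<in> start_states G lab v" by blast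
  from \<open>q \<in> end_states G lab u\<close>
  obtain e where e: "label_path G e" "\<forall>i<length u. lab (e i) = u ! i" "q = tail G (e (length u))"
    unfolding end_states_def by (rule CollectE) blast
  from \<open>q \<in> start_states G lab v\<close>
  obtain f where f: "label_path G f" "\<forall>i<length v. lab (f i) = v ! i" "q = tail G (f 0)"
    unfolding start_states_def by (rule CollectE) blast
  define h where "h n = (if n < length u then e n else f (n - length u))" for n
  have "label_path G h"
    unfolding label_path_def
  proof
    fix n
    consider "Suc n < length u" | "Suc n = length u" | "n \<ge> length u" by linarith
    then show "h n \<in> arcs G \<and> head G (h n) = tail G (h (Suc n))"
    proof cases
      case 1
      then show ?thesis using e(1) by (simp add: h_def label_path_def)
    next
      \<comment> \<open>This is the seam: the last arc used from \<open>e\<close> ends at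
        \<open>q\<close>, where \<open>f\<close> starts.\<close>
      case 2
      then have "h n = e n" "h (Suc n) = f 0" by (auto simp: h_def)
      then show ?thesis using e(1,3) f(3) 2 by (metis label_path_def)
    next
      case 3
      then show ?thesis using f(1) by (simp add: h_def label_path_def Suc_diff_le)
    qed
  qed
  then have "(\<lambda>n. lab (h n)) \<in> label_sequences G lab"
    by (auto simp: label_sequences_def label_path_def)
  then show "u @ v \<in> language (label_sequences G lab)"
    by (rule languageI) (auto simp: h_def nth_append e(2) f(2))
qed

definition follower_set :: "(nat \<Rightarrow> 'a) set \<Rightarrow> 'a list \<Rightarrow> 'a list set" where
  "follower_set \<Sigma> u = {v. u @ v \<in> language \<Sigma>}"

definition predecessor_set :: "(nat \<Rightarrow> 'a) set \<Rightarrow> 'a list \<Rightarrow> 'a list set" where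
  "predecessor_set \<Sigma> v = {u. u @ v \<in> language \<Sigma>}"

text \<open>Each of these sets depends only on a set of vertices, and a finite graph has finitely
  many of those.\<close>

lemma sofic_finite_follower_predecessor_sets:
  assumes "sofic \<Sigma>"
  shows "finite (range (follower_set \<Sigma>))" and "finite (range (predecessor_set \<Sigma>))"
proof -
  obtain G :: "(nat, nat) pre_digraph" and lab
    where G: "fin_digraph G" and \<Sigma>: "\<Sigma> = label_sequences G lab"
    using assms unfolding sofic_def by blast
  interpret fin_digraph G by (rule G)
  have e: "end_states G lab u \<in> Pow (verts G)" and s: "start_states G lab u \<in> Pow (verts G)" for u
    unfolding end_states_def start_states_def label_path_def by auto
  have "range (follower_set \<Sigma>) \<subseteq> (\<lambda>Q. {v. Q \<inter> start_states G lab v \<noteq> {}}) ` Pow (verts G)"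
    unfolding follower_set_def \<Sigma> append_mem_language_label_sequences using e by blast
  then show "finite (range (follower_set \<Sigma>))"
    by (rule finite_subset) simp
  have "range (predecessor_set \<Sigma>) \<subseteq> (\<lambda>Q. {u. end_states G lab u \<inter> Q \<noteq> {}}) ` Pow (verts G)"
    unfolding predecessor_set_def \<Sigma> append_mem_language_label_sequences using s by blast
  then show "finite (range (predecessor_set \<Sigma>))"
    by (rule finite_subset) simp
qed

text \<open>One witness is chosen for each value of \<open>\<kappa>\<close>, and invariance lets it
  serve the whole class. This turns mere existence of connecting words into a bound on their
  length.\<close>

lemma finite_uniform_witnesses:
  assumes fin: "finite (\<kappa> ` X)" and ex: "\<And>x. x \<in> X \<Longrightarrow> \<exists>z. Q x z"
    and invariant: "\<And>x y z. \<kappa> x = \<kappa> y \<Longrightarrow> Q x z \<Longrightarrow> Q y z"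
  shows "\<exists>Z. finite Z \<and> (\<forall>x\<in>X. \<exists>z\<in>Z. Q x z)"
proof -
  define \<zeta> where "\<zeta> c = (SOME z. \<exists>x. \<kappa> x = c \<and> Q x z)" for c
  have "Q x (\<zeta> (\<kappa> x))" if x: "x \<in> X" for x
  proof -
    obtain z where "Q x z" using ex[OF x] ..
    then have "\<exists>z y. \<kappa> y = \<kappa> x \<and> Q y z" by blast
    from someI_ex[OF this] obtain y where "\<kappa> y = \<kappa> x" "Q y (\<zeta> (\<kappa> x))"
      unfolding \<zeta>_def by blast
    then show ?thesis by (rule invariant)
  qed
  then have "\<forall>x\<in>X. \<exists>z\<in>\<zeta> ` \<kappa> ` X. Q x z" by blast
  with fin show ?thesis by blast
qed

section \<open>Repeated words modulo the step of a progression\<close>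

text \<open>Common factors of \<open>g\<close> and \<open>d\<close> are removed one gcd at a time,
  each paid for by one more power of \<open>g\<close>; the remaining \<open>e\<close> is coprime to
  \<open>g\<close>, so that Euler's theorem applies to it.\<close>

lemma split_off_coprime_part:
  fixes g d :: nat
  assumes "d > 0"
  obtains k e where "e > 0" "coprime g e" "d dvd g ^ k * e"
  using assms
proof (induction d arbitrary: thesis rule: less_induct)
  case (less d)
  show ?case
  proof (cases "coprime g d")
    case True
    then show ?thesis using less.prems(1)[of d 0] less.prems(2) by simp
  next
    case False
    define p where "p = gcd g d"
    have "p \<noteq> 1" using False coprime_iff_gcd_eq_1[of g d] unfolding p_def by blast
    moreover have "p > 0" using less.prems(2) by (simp add: p_def)
    ultimately have "p > 1" by linarith
    obtain d' where d': "d = p * d'" using gcd_dvd2[of g d] unfolding p_def by (rule dvdE)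
    have "d' < d" "d' > 0" using less.prems(2) \<open>p > 1\<close> by (simp_all add: d')
    then obtain k e where ke: "e > 0" "coprime g e" "d' dvd g ^ k * e"
      using less.IH by blast
    have "p * d' dvd g * (g ^ k * e)"
      by (rule mult_dvd_mono) (simp_all add: p_def ke)
    then show ?thesis
      using less.prems(1)[of e "Suc k"] ke by (simp add: d' mult.assoc)
  qed
qed

text \<open>The sum runs over \<open>e\<close> full periods of the powers of \<open>q\<close> modulo \<open>e\<close>.\<close>
lemma geometric_sum_dvd:
  fixes q e :: nat
  assumes "coprime q e" "e > 0"
  shows "e dvd (\<Sum>j<e * totient e. q ^ j)"
proof -
  define t where "t = totient e"
  have "[(\<Sum>j<e * t. q ^ j) = (\<Sum>m<e. \<Sum>j<t. q ^ j)] (mod e)"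
  proof -
    have "(\<Sum>j<e * t. q ^ j) = (\<Sum>m<e. \<Sum>j\<in>{m * t..<m * t + t}. q ^ j)"
      by (rule sum.nat_group[symmetric])
    also have "\<dots> = (\<Sum>m<e. \<Sum>j<t. (q ^ t) ^ m * q ^ j)"
    proof (rule sum.cong[OF refl])
      fix m
      have "(\<Sum>j\<in>{m * t..<m * t + t}. q ^ j) = (\<Sum>j<t. q ^ (j + m * t))"
        using sum.shift_bounds_nat_ivl[of "\<lambda>j. q ^ j" 0 "m * t" t]
        by (simp add: add.commute atLeast0LessThan)
      then show "(\<Sum>j\<in>{m * t..<m * t + t}. q ^ j) = (\<Sum>j<t. (q ^ t) ^ m * q ^ j)"
        by (simp add: power_add power_mult[symmetric] mult.commute)
    qed
    \<comment> \<open>By Euler's theorem \<open>q ^ t\<close> is 1 modulo \<open>e\<close>, so all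
      \<open>e\<close> blocks are congruent and their sum is a multiple of \<open>e\<close>.\<close>
    also have "[\<dots> = (\<Sum>m<e. \<Sum>j<t. 1 ^ m * q ^ j)] (mod e)"
      by (intro cong_sum cong_mult cong_pow cong_refl) (use euler_theorem[of q e] assms t_def in simp)
    finally show ?thesis by simp
  qed
  also have "(\<Sum>m<e. \<Sum>j<t. q ^ j) = e * (\<Sum>j<t. q ^ j)" by simp
  finally show ?thesis
    unfolding t_def using cong_dvd_iff by (metis dvd_triv_left)
qed

definition word_power :: "'a list \<Rightarrow> nat \<Rightarrow> 'a list" where
  "word_power c n = concat (replicate n c)"

lemma word_power_0 [simp]: "word_power c 0 = []"
  by (simp add: word_power_def)

lemma word_power_Suc: "word_power c (Suc n) = c @ word_power c n"
  by (simp add: word_power_def)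

lemma word_power_Suc': "word_power c (Suc n) = word_power c n @ c"
  by (induction n) (simp_all add: word_power_Suc)

lemma word_value_word_power:
  "word_value g (word_power c n) = word_value g c * (\<Sum>j<n. (g ^ length c) ^ j)"
proof (induction n)
  case (Suc n)
  have "length (word_power c n) = n * length c"
    by (simp add: word_power_def length_concat sum_list_replicate)
  then show ?case
    using Suc by (simp add: word_power_Suc' word_value_append algebra_simps power_mult[symmetric])
qed simp

text \<open>The prefix \<open>w\<close> shifts the appended digits by at least \<open>k\<close>
  places and so supplies \<open>g ^ k\<close>; the repetition supplies \<open>e\<close>. The number
  of repetitions is independent of \<open>c\<close>.\<close>

lemma word_value_append_word_power_cong:
  assumes "e > 0" "coprime g e" "d dvd g ^ k * e" "k \<le> length w"
  shows "[word_value g (w @ word_power c (e * totient e)) = word_value g w] (mod d)"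
proof -
  have "e dvd word_value g (word_power c (e * totient e))"
    unfolding word_value_word_power using assms by (intro dvd_mult geometric_sum_dvd) auto
  moreover have "g ^ k dvd g ^ length w"
    using assms by (intro le_imp_power_dvd)
  ultimately have "d dvd g ^ length w * word_value g (word_power c (e * totient e))"
    using assms(3) by (meson dvd_trans mult_dvd_mono)
  then show ?thesis
    by (simp add: word_value_append cong_def mod_eq_0_iff_dvd) (metis add.right_neutral dvd_imp_mod_0 mod_add_right_eq)
qed

section \<open>Synchronization and growth inside a progression\<close>

context shift_space
begin

text \<open>A word whose follower set is minimal is synchronizing.\<close>
lemma synchronizing_word_exists:
  assumes "sofic \<Sigma>"
  obtains s where "s \<in> language \<Sigma>"
    "\<And>u. u @ s \<in> language \<Sigma> \<Longrightarrow> follower_set \<Sigma> (u @ s) = follower_set \<Sigma> s"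
proof -
  have "finite (follower_set \<Sigma> ` language \<Sigma>)"
    by (rule finite_subset[OF image_mono sofic_finite_follower_predecessor_sets(1)[OF assms]]) simp
  moreover have "language \<Sigma> \<noteq> {}"
    using words_ne[of 0] by (auto simp: words_def)
  ultimately obtain F where F: "F \<in> follower_set \<Sigma> ` language \<Sigma>"
    and minF: "\<forall>F'\<in>follower_set \<Sigma> ` language \<Sigma>. F' \<subseteq> F \<longrightarrow> F = F'"
    using finite_has_minimal[of "follower_set \<Sigma> ` language \<Sigma>"] by blast
  then obtain s where s: "s \<in> language \<Sigma>" "F = follower_set \<Sigma> s" by blast
  then have min: "follower_set \<Sigma> s = follower_set \<Sigma> w"
    if "w \<in> language \<Sigma>" "follower_set \<Sigma> w \<subseteq> follower_set \<Sigma> s" for w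
    using minF that by blast
  have "follower_set \<Sigma> (u @ s) = follower_set \<Sigma> s" if "u @ s \<in> language \<Sigma>" for u
  proof -
    \<comment> \<open>Prepending letters can only shrink a follower set; minimality then forces
      equality.\<close>
    have "follower_set \<Sigma> (u @ s) \<subseteq> follower_set \<Sigma> s"
    proof
      fix v assume "v \<in> follower_set \<Sigma> (u @ s)"
      then have "u @ (s @ v) \<in> language \<Sigma>" by (simp add: follower_set_def)
      from language_appendD2[OF this] show "v \<in> follower_set \<Sigma> s"
        by (simp add: follower_set_def)
    qed
    then show ?thesis using min[OF that] by simp
  qed
  with s(1) show ?thesis by (rule that)
qed

text \<open>The loop \<open>c\<close> returns to the follower set of \<open>w @ t @ s\<close>, so it can be repeated until its value
  vanishes modulo \<open>d\<close>.\<close>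
lemma return_to_residue_class:
  assumes trans: "transitive_shift \<Sigma>"
    and sync: "\<And>u. u @ s \<in> language \<Sigma> \<Longrightarrow> follower_set \<Sigma> (u @ s) = follower_set \<Sigma> s"
    and p: "w @ t @ s \<in> language \<Sigma>" and x: "(w @ t @ s) @ v \<in> language \<Sigma>"
    and e: "e > 0" "coprime g e" "d dvd g ^ k * e" "k \<le> length w"
  obtains z where "((w @ t @ s) @ v) @ z \<in> language \<Sigma>"
    "[word_value g (((w @ t @ s) @ v) @ z) = word_value g w] (mod d)"
proof -
  obtain r where r: "((w @ t @ s) @ v) @ r @ (w @ t @ s) \<in> language \<Sigma>"
    using trans x p unfolding transitive_shift_def by blast
  \<comment> \<open>The stretch read from the end of the first \<open>w\<close> to the end of the
    next one.\<close>
  define c where "c = t @ s @ v @ r @ w"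
  have loop: "w @ word_power c n @ t @ s \<in> language \<Sigma>" for n
  proof (induction n)
    case (Suc n)
    \<comment> \<open>Both words end in the synchronizing \<open>s\<close>, so whatever may follow
      one may follow the other; hence the loop can be entered again.\<close>
    have "follower_set \<Sigma> (w @ word_power c n @ t @ s) = follower_set \<Sigma> (w @ t @ s)"
      using sync[of "w @ word_power c n @ t"] sync[of "w @ t"] Suc p by simp
    moreover have "v @ r @ w @ t @ s \<in> follower_set \<Sigma> (w @ t @ s)"
      using r by (simp add: follower_set_def)
    ultimately have "v @ r @ w @ t @ s \<in> follower_set \<Sigma> (w @ word_power c n @ t @ s)"
      by simp
    then show ?case
      by (simp add: follower_set_def word_power_Suc' c_def)
  qed (use p in simp)
  define N where "N = e * totient e"
  have "N > 0" using e(1) by (simp add: N_def)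
  then obtain M where M: "N = Suc M" by (cases N) auto
  \<comment> \<open>What is left of \<open>w @ word_power c N\<close> after the given beginning
    \<open>w @ t @ s @ v\<close>; the first loop exists because \<open>N > 0\<close>.\<close>
  define z where "z = r @ w @ word_power c M"
  have eq: "w @ word_power c N = ((w @ t @ s) @ v) @ z"
    by (simp add: M word_power_Suc z_def c_def)
  have "w @ word_power c N \<in> language \<Sigma>"
    using loop[of N] language_appendD1[of "w @ word_power c N" "t @ s"] by simp
  moreover have "[word_value g (w @ word_power c N) = word_value g w] (mod d)"
    unfolding N_def by (rule word_value_append_word_power_cong[OF e])
  ultimately show ?thesis
    unfolding eq by (rule that)
qed

text \<open>Each word \<open>v\<close> of length \<open>m\<close> is sent to the value of
  \<open>p @ r @ v @ z\<close>, with \<open>r\<close> and \<open>z\<close> from finite sets. The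
  factor \<open>D\<close> counts the choices of \<open>r\<close>, and \<open>C\<close> bounds the
  added length.\<close>

lemma residue_class_growth:
  assumes trans: "transitive_shift \<Sigma>" and sofic: "sofic \<Sigma>" and d: "d > 0"
    and inf: "infinite (shift_numbers g \<Sigma> \<inter> {a + k * d | k. True})"
  obtains D C where "\<And>m. card (words \<Sigma> m) \<le>
    D * card (shift_numbers g \<Sigma> \<inter> {a + k * d | k. True} \<inter> {..<g ^ (m + C)})"
proof -
  define B where "B = shift_numbers g \<Sigma> \<inter> {a + k * d | k. True}"
  obtain k e where e: "e > 0" "coprime g e" "d dvd g ^ k * e"
    using split_off_coprime_part[OF d] .
  \<comment> \<open>A member of at least \<open>g ^ k\<close> comes from a word of length at least
    \<open>k\<close>, as needed to absorb the part of \<open>d\<close> not coprime to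
    \<open>g\<close>.\<close>
  have "\<not> B \<subseteq> {..<g ^ k}"
    using inf finite_subset unfolding B_def by blast
  then obtain w where w: "w \<in> language \<Sigma>" "word_value g w \<in> B" "\<not> word_value g w < g ^ k"
    unfolding B_def shift_numbers_def by blast
  have k: "k \<le> length w"
  proof (rule ccontr)
    assume "\<not> k \<le> length w"
    then have "g ^ length w \<le> g ^ k" using g_ge_2 by (intro power_increasing) auto
    then show False using w(3) word_value_less[OF language_digits[OF w(1)]] by simp
  qed
  \<comment> \<open>Congruence alone does not place a number in the progression, which starts at
    \<open>a\<close>; appending digits never lowers the value, so it stays at or above
    \<open>a\<close>.\<close>
  have mem_B: "word_value g (w @ y) \<in> B"
    if "w @ y \<in> language \<Sigma>" "[word_value g (w @ y) = word_value g w] (mod d)" for y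
  proof -
    obtain j where j: "word_value g w = a + j * d"
      using w(2) unfolding B_def by blast
    have le: "word_value g w \<le> word_value g (w @ y)"
      by (simp add: word_value_append)
    then have "d dvd word_value g (w @ y) - word_value g w"
      using that(2) by (simp add: cong_altdef_nat)
    with le obtain i where "word_value g (w @ y) = word_value g w + d * i"
      by (metis dvdE le_add_diff_inverse)
    then have "word_value g (w @ y) = a + (j + i) * d"
      by (simp add: j algebra_simps)
    then show ?thesis
      using that(1) unfolding B_def shift_numbers_def by blast
  qed
  obtain s where s: "s \<in> language \<Sigma>"
    and sync: "\<And>u. u @ s \<in> language \<Sigma> \<Longrightarrow> follower_set \<Sigma> (u @ s) = follower_set \<Sigma> s"
    using synchronizing_word_exists[OF sofic] by blast
  obtain t where p: "w @ t @ s \<in> language \<Sigma>"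
    using trans w(1) s unfolding transitive_shift_def by blast
  define p where "p = w @ t @ s"
  have "\<exists>R. finite R \<and> (\<forall>v\<in>language \<Sigma>. \<exists>r\<in>R. p @ r @ v \<in> language \<Sigma>)"
  proof (rule finite_uniform_witnesses[of "predecessor_set \<Sigma>"])
    show "finite (predecessor_set \<Sigma> ` language \<Sigma>)"
      by (rule finite_subset[OF image_mono sofic_finite_follower_predecessor_sets(2)[OF sofic]]) simp
    show "\<exists>r. p @ r @ v \<in> language \<Sigma>" if "v \<in> language \<Sigma>" for v
      using trans p that unfolding transitive_shift_def p_def by blast
    show "p @ r @ y \<in> language \<Sigma>"
      if "predecessor_set \<Sigma> x = predecessor_set \<Sigma> y" "p @ r @ x \<in> language \<Sigma>" for x y r
    proof -
      have "p @ r \<in> predecessor_set \<Sigma> x" using that(2) by (simp add: predecessor_set_def)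
      then show ?thesis unfolding that(1) by (simp add: predecessor_set_def)
    qed
  qed
  then obtain R where R: "finite R" "\<forall>v\<in>language \<Sigma>. \<exists>r\<in>R. p @ r @ v \<in> language \<Sigma>"
    by blast
  define X where "X = {x \<in> language \<Sigma>. \<exists>v. x = p @ v}"
  \<comment> \<open>The follower set decides whether \<open>x @ z\<close> is in the language; the
    two residues determine its value modulo \<open>d\<close>, which is
    \<open>word_value g x + g ^ length x * word_value g z\<close>.\<close>
  define \<kappa> where "\<kappa> x = (follower_set \<Sigma> x, word_value g x mod d, g ^ length x mod d)" for x
  define Q where "Q x z \<longleftrightarrow> x @ z \<in> language \<Sigma> \<and> [word_value g (x @ z) = word_value g w] (mod d)" for x z
  have "\<exists>Z. finite Z \<and> (\<forall>x\<in>X. \<exists>z\<in>Z. Q x z)"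
  proof (rule finite_uniform_witnesses[of \<kappa>])
    show "\<exists>z. Q x z" if x: "x \<in> X" for x
    proof -
      obtain v where v: "x = p @ v" "p @ v \<in> language \<Sigma>" using x unfolding X_def by blast
      obtain z where "((w @ t @ s) @ v) @ z \<in> language \<Sigma>"
        "[word_value g (((w @ t @ s) @ v) @ z) = word_value g w] (mod d)"
        by (rule return_to_residue_class[OF trans sync p v(2)[unfolded p_def] e k])
      then show ?thesis
        unfolding Q_def v(1) p_def by blast
    qed
    have "\<kappa> ` X \<subseteq> range (follower_set \<Sigma>) \<times> {..<d} \<times> {..<d}"
      using d by (auto simp: \<kappa>_def)
    then show "finite (\<kappa> ` X)"
      by (rule finite_subset) (use sofic_finite_follower_predecessor_sets(1)[OF sofic] in simp)
    show "Q y z" if "\<kappa> x = \<kappa> y" "Q x z" for x y z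
    proof -
      have f: "follower_set \<Sigma> x = follower_set \<Sigma> y" and v: "[word_value g x = word_value g y] (mod d)"
        and l: "[g ^ length x = g ^ length y] (mod d)"
        using that(1) by (simp_all add: \<kappa>_def cong_def)
      have "z \<in> follower_set \<Sigma> x" using that(2) by (simp add: Q_def follower_set_def)
      then have "y @ z \<in> language \<Sigma>" unfolding f by (simp add: follower_set_def)
      moreover have "[word_value g (y @ z) = word_value g (x @ z)] (mod d)"
        unfolding word_value_append by (intro cong_add cong_mult cong_sym[OF v] cong_sym[OF l] cong_refl)
      ultimately show ?thesis
        using that(2) cong_trans unfolding Q_def by blast
    qed
  qed
  then obtain Z where Z: "finite Z" "\<forall>x\<in>X. \<exists>z\<in>Z. Q x z"
    by blast
  then obtain \<zeta> where \<zeta>: "\<forall>x\<in>X. \<zeta> x \<in> Z \<and> Q x (\<zeta> x)"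
    using bchoice[of X "\<lambda>x z. z \<in> Z \<and> Q x z"] by blast
  define C where "C = length p + Max (length ` R) + Max (length ` Z)"
  have "card (words \<Sigma> m) \<le> card R * card (B \<inter> {..<g ^ (m + C)})" for m
  proof -
    define V where "V r = {v \<in> words \<Sigma> m. p @ r @ v \<in> language \<Sigma>}" for r
    have "words \<Sigma> m \<subseteq> (\<Union>r\<in>R. V r)"
      using R(2) unfolding V_def words_def by blast
    then have "card (words \<Sigma> m) \<le> card (\<Union>r\<in>R. V r)"
      by (rule card_mono[rotated]) (simp add: R(1) V_def)
    also have "\<dots> \<le> (\<Sum>r\<in>R. card (V r))"
      by (rule card_UN_le[OF R(1)])
    also have "\<dots> \<le> (\<Sum>r\<in>R. card (B \<inter> {..<g ^ (m + C)}))"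
    proof (rule sum_mono)
      fix r assume r: "r \<in> R"
      define \<phi> where "\<phi> v = word_value g ((p @ r @ v) @ \<zeta> (p @ r @ v))" for v
      have X: "p @ r @ v \<in> X" if "v \<in> V r" for v
        using that unfolding V_def X_def by blast
      \<comment> \<open>The ending depends on \<open>v\<close>, but for fixed \<open>r\<close> all
        words \<open>p @ r @ v\<close> have the same length and are recovered from the low-order
        digits.\<close>
      have "inj_on \<phi> (V r)"
      proof (rule inj_onI)
        fix u v assume uv: "u \<in> V r" "v \<in> V r" "\<phi> u = \<phi> v"
        have "p @ r @ u = p @ r @ v"
          by (rule append_eq_if_word_value_eq[OF uv(3)[unfolded \<phi>_def]])
            (use uv in \<open>simp_all add: V_def words_def language_digits del: set_append\<close>)
        then show "u = v" by simp
      qed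
      moreover have "\<phi> ` V r \<subseteq> B \<inter> {..<g ^ (m + C)}"
      proof
        fix b assume "b \<in> \<phi> ` V r"
        then obtain v where v: "v \<in> V r" "b = \<phi> v" by blast
        define z where "z = \<zeta> (p @ r @ v)"
        have z: "z \<in> Z" "Q (p @ r @ v) z"
          using bspec[OF \<zeta> X[OF v(1)]] by (simp_all add: z_def)
        have b: "b = word_value g (w @ (t @ s @ r @ v @ z))"
          by (simp add: v(2) \<phi>_def z_def p_def)
        have "b \<in> B"
          unfolding b using z(2) by (intro mem_B) (simp_all add: Q_def p_def)
        moreover have "b < g ^ (m + C)"
        proof -
          have "length r \<le> Max (length ` R)" "length z \<le> Max (length ` Z)"
            using r z(1) R(1) Z(1) by simp_all
          moreover have "length v = m"
            using v(1) by (simp add: V_def words_def)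
          ultimately have "length ((p @ r @ v) @ z) \<le> m + C"
            by (simp add: C_def)
          then have "g ^ length ((p @ r @ v) @ z) \<le> g ^ (m + C)"
            using g_ge_2 by (intro power_increasing) auto
          moreover have "b < g ^ length ((p @ r @ v) @ z)"
            unfolding v(2) \<phi>_def z_def[symmetric]
            by (rule word_value_less[OF language_digits]) (use z(2) in \<open>simp add: Q_def\<close>)
          ultimately show ?thesis by simp
        qed
        ultimately show "b \<in> B \<inter> {..<g ^ (m + C)}" by simp
      qed
      ultimately show "card (V r) \<le> card (B \<inter> {..<g ^ (m + C)})"
        by (rule card_inj_on_le) simp
    qed
    finally show ?thesis by simp
  qed
  then show ?thesis
    unfolding B_def by (rule that)
qed

text \<open>A finite intersection has dimension 0. An infinite one has growth rate \<open>h\<close>: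
  the lower bound is the injection above, the upper bound is inclusion in the full set.\<close>

lemma transitive_sofic_dimension_dichotomy:
  assumes "transitive_shift \<Sigma>" "sofic \<Sigma>" and P: "infinite_arith_prog P"
  obtains \<delta> where "has_mass_dimension (shift_numbers g \<Sigma>) \<delta>"
    "has_mass_dimension (shift_numbers g \<Sigma> \<inter> P) 0 \<or> has_mass_dimension (shift_numbers g \<Sigma> \<inter> P) \<delta>"
proof -
  obtain h where h: "(\<lambda>n. ln (real (card (words \<Sigma> n))) / real n) \<longlonglongrightarrow> h"
    by (rule growth_rate_exists)
  show ?thesis
  proof (rule that[OF has_mass_dimension_shift_numbers[OF h]])
    show "has_mass_dimension (shift_numbers g \<Sigma> \<inter> P) 0 \<or>
      has_mass_dimension (shift_numbers g \<Sigma> \<inter> P) (h / ln (real g))"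
    proof (cases "finite (shift_numbers g \<Sigma> \<inter> P)")
      case True
      then show ?thesis by (simp add: has_mass_dimension_finite)
    next
      case False
      obtain a d where d: "d > 0" "P = {a + k * d | k. True}"
        using P unfolding infinite_arith_prog_def by blast
      obtain D C where DC: "\<And>m. card (words \<Sigma> m) \<le>
          D * card (shift_numbers g \<Sigma> \<inter> P \<inter> {..<g ^ (m + C)})"
        using residue_class_growth[OF assms(1,2) d(1)] False unfolding d(2) by blast
      have "card (shift_numbers g \<Sigma> \<inter> P \<inter> {..<g ^ n}) \<le> (n + 1) * card (words \<Sigma> n)" for n
        by (rule order_trans[OF card_mono card_shift_numbers_upper]) auto
      then have "(\<lambda>n. ln (real (card (shift_numbers g \<Sigma> \<inter> P \<inter> {..<g ^ n}))) / real n) \<longlonglongrightarrow> h"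
        by (rule growth_rate_sandwich[OF h card_words_pos DC])
      then show ?thesis
        using False by (intro disjI2 has_mass_dimension_powersI[OF g_ge_2]) auto
    qed
  qed
qed

end

section \<open>Counterexamples\<close>

lemma word_starting_with_zero:
  "{w \<in> words \<Sigma> (Suc m). \<exists>v. w = 0 # v} = (\<lambda>x. map x [0..<Suc m]) ` {x \<in> \<Sigma>. x 0 = 0}"
  unfolding words_eq map_upt_Suc by fastforce

text \<open>Words without 0 give entropy at least \<open>ln 9\<close>. Multiples of 10 select words
  starting with 0, whose growth is at most \<open>ln 6\<close> by \<open>few\<close> and bounded
  away from 0 by \<open>sparse\<close>. Hence neither 0 nor the full dimension is possible.\<close>

lemma decimal_counterexample:
  assumes subshift: "subshift 10 \<Sigma>"
    and nonzero: "\<And>x. (\<And>i. x i \<in> {1..9}) \<Longrightarrow> x \<in> \<Sigma>"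
    and sparse: "\<And>x. x 0 = 0 \<Longrightarrow> (\<And>i. odd i \<Longrightarrow> x i = 1) \<Longrightarrow> (\<And>i. x i \<le> 1) \<Longrightarrow> x \<in> \<Sigma>"
    and few: "\<And>m. card {w \<in> words \<Sigma> (Suc m). \<exists>v. w = 0 # v} \<le> 6 ^ Suc m"
  shows "\<exists>P. infinite_arith_prog P \<and> (\<exists>\<delta>. has_mass_dimension (shift_numbers 10 \<Sigma>) \<delta> \<and>
    \<not> (has_mass_dimension (shift_numbers 10 \<Sigma> \<inter> P) 0 \<or> has_mass_dimension (shift_numbers 10 \<Sigma> \<inter> P) \<delta>))"
proof -
  interpret shift_space 10 \<Sigma> by unfold_locales (use subshift in auto)
  obtain h where h: "(\<lambda>n. ln (real (card (words \<Sigma> n))) / real n) \<longlonglongrightarrow> h"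
    by (rule growth_rate_exists)
  have many: "9 ^ n \<le> card (words \<Sigma> n)" for n
  proof -
    have "{w. set w \<subseteq> {1..9::nat} \<and> length w = n} \<subseteq> words \<Sigma> n"
    proof
      fix w :: "nat list" assume "w \<in> {w. set w \<subseteq> {1..9} \<and> length w = n}"
      then have w: "set w \<subseteq> {1..9}" "length w = n" by auto
      define x where "x i = (if i < n then w ! i else 1)" for i
      have "x i \<in> {1..9}" for i
        using w subsetD[OF w(1) nth_mem, of i] by (simp add: x_def)
      then have "x \<in> \<Sigma>" by (rule nonzero)
      then have "w \<in> language \<Sigma>"
        by (rule languageI) (simp add: x_def w(2))
      then show "w \<in> words \<Sigma> n" using w(2) by (simp add: words_def)
    qed
    from card_mono[OF finite_words this] show ?thesis
      by (simp add: card_lists_length_eq)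
  qed
  have h_ge: "ln 9 \<le> h"
  proof (rule LIMSEQ_le_const[OF h], intro exI allI impI)
    fix n :: nat assume "n \<ge> 1"
    have "ln (real (9 ^ n)) \<le> ln (real (card (words \<Sigma> n)))"
      by (rule ln_real_mono_nat[OF many])
    then show "ln 9 \<le> ln (real (card (words \<Sigma> n))) / real n"
      using \<open>n \<ge> 1\<close> by (simp add: ln_realpow field_simps)
  qed
  define P :: "nat set" where "P = {0 + k * 10 | k. True}"
  define B where "B = shift_numbers 10 \<Sigma> \<inter> P"
  have P: "infinite_arith_prog P"
    unfolding infinite_arith_prog_def P_def by (intro exI[of _ 0] exI[of _ 10]) simp
  have mem_P: "n \<in> P \<longleftrightarrow> n mod 10 = 0" for n
    unfolding P_def by (auto simp: mod_eq_0_iff_dvd dvd_def mult.commute)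
  \<comment> \<open>Nonemptiness keeps the convention for the empty set out of play.\<close>
  have B0: "0 \<in> B"
    using zero_mem_shift_numbers by (simp add: B_def mem_P)
  define W where "W m = {w \<in> words \<Sigma> (Suc m). \<exists>v. w = 0 # v}" for m
  have upper: "card (B \<inter> {..<10 ^ n}) \<le> (n + 2) * 6 ^ n" for n
  proof -
    \<comment> \<open>The empty word has value 0 but no first letter, so 0 is listed
      separately.\<close>
    have "B \<inter> {..<10 ^ n} \<subseteq> insert 0 (\<Union>m<n. word_value 10 ` W m)"
    proof
      fix b assume b: "b \<in> B \<inter> {..<10 ^ n}"
      then have "b \<in> (\<Union>m\<le>n. word_value 10 ` words \<Sigma> m)"
        unfolding shift_numbers_below_power[symmetric] by (simp add: B_def)
      then obtain m w where w: "m \<le> n" "w \<in> words \<Sigma> m" "b = word_value 10 w" by blast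
      show "b \<in> insert 0 (\<Union>m<n. word_value 10 ` W m)"
      proof (cases w)
        case Nil
        then show ?thesis using w(3) by simp
      next
        case (Cons a v)
        have "a < 10" using words_subset w(2) Cons by fastforce
        moreover have "(a + 10 * word_value 10 v) mod 10 = 0"
          using b w(3) Cons by (simp add: B_def mem_P)
        ultimately have "a = 0" by simp
        have "m = Suc (length v)" using w(2) Cons by (simp add: words_def)
        then have "w \<in> W (length v)" "length v < n"
          using w(1,2) Cons \<open>a = 0\<close> by (auto simp: W_def)
        then show ?thesis using w(3) by blast
      qed
    qed
    then have "card (B \<inter> {..<10 ^ n}) \<le> card (insert 0 (\<Union>m<n. word_value 10 ` W m))"
      by (rule card_mono[rotated]) (simp add: W_def)
    also have "\<dots> \<le> Suc (card (\<Union>m<n. word_value 10 ` W m))"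
      by (rule card_insert_le_m1) simp_all
    also have "card (\<Union>m<n. word_value 10 ` W m) \<le> (\<Sum>m<n. card (word_value 10 ` W m))"
      by (rule card_UN_le) simp
    also have "\<dots> \<le> (\<Sum>m<n. 6 ^ n)"
    proof (rule sum_mono)
      fix m assume m: "m \<in> {..<n}"
      have "card (word_value 10 ` W m) \<le> card (W m)"
        by (rule card_image_le) (simp add: W_def)
      also have "\<dots> \<le> 6 ^ Suc m" unfolding W_def by (rule few)
      also have "\<dots> \<le> 6 ^ n" using m by (intro power_increasing) auto
      finally show "card (word_value 10 ` W m) \<le> 6 ^ n" .
    qed
    finally have "card (B \<inter> {..<10 ^ n}) \<le> Suc (n * 6 ^ n)" by simp
    moreover have "(1::nat) \<le> 6 ^ n" by simp
    ultimately show ?thesis by (simp only: add_mult_distrib)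
  qed
  have lower: "2 ^ n \<le> card (B \<inter> {..<10 ^ (2 * n + 1)})" for n
  proof -
    \<comment> \<open>Odd positions carry 1, and \<open>S\<close> encodes a free binary choice at
      the even positions; subsets of \<open>{1..n}\<close> leave position 0 equal to 0.\<close>
    define x :: "nat set \<Rightarrow> nat \<Rightarrow> nat"
      where "x S i = (if odd i \<or> i div 2 \<in> S then 1 else 0)" for S i
    define \<phi> where "\<phi> S = word_value 10 (map (x S) [0..<Suc (2 * n)])" for S
    have x_mem: "x S \<in> \<Sigma>" if "S \<in> Pow {1..n}" for S
      by (rule sparse) (use that in \<open>auto simp: x_def\<close>)
    have words: "map (x S) [0..<Suc (2 * n)] \<in> words \<Sigma> (Suc (2 * n))" if "S \<in> Pow {1..n}" for S
      unfolding words_eq using x_mem[OF that] by blast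
    have "inj_on \<phi> (Pow {1..n})"
    proof (rule inj_onI)
      fix S T assume ST: "S \<in> Pow {1..n}" "T \<in> Pow {1..n}" "\<phi> S = \<phi> T"
      have eq: "map (x S) [0..<Suc (2 * n)] = map (x T) [0..<Suc (2 * n)]"
        using inj_onD[OF inj_on_word_value_words] ST(3)[unfolded \<phi>_def] words[OF ST(1)] words[OF ST(2)] .
      have "j \<in> S \<longleftrightarrow> j \<in> T" if "j \<in> {1..n}" for j
      proof -
        have "map (x S) [0..<Suc (2 * n)] ! (2 * j) = map (x T) [0..<Suc (2 * n)] ! (2 * j)"
          by (simp only: eq)
        moreover have "2 * j < Suc (2 * n)" using that by simp
        ultimately have "x S (2 * j) = x T (2 * j)" by (simp del: upt_Suc)
        then show ?thesis by (simp add: x_def split: if_splits)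
      qed
      then show "S = T" using ST(1,2) by blast
    qed
    moreover have "\<phi> ` Pow {1..n} \<subseteq> B \<inter> {..<10 ^ (2 * n + 1)}"
    proof
      fix b assume "b \<in> \<phi> ` Pow {1..n}"
      then obtain S where S: "S \<in> Pow {1..n}" "b = \<phi> S" by blast
      have "b \<in> shift_numbers 10 \<Sigma> \<inter> {..<10 ^ (2 * n + 1)}"
        unfolding shift_numbers_below_power S(2) \<phi>_def using words[OF S(1)] by force
      moreover have "x S 0 = 0" using S(1) by (auto simp: x_def)
      then have "b \<in> P"
        unfolding mem_P S(2) \<phi>_def map_upt_Suc by simp
      ultimately show "b \<in> B \<inter> {..<10 ^ (2 * n + 1)}" by (simp add: B_def)
    qed
    ultimately have "card (Pow {1..n}) \<le> card (B \<inter> {..<10 ^ (2 * n + 1)})"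
      by (rule card_inj_on_le) simp
    then show ?thesis by (simp add: card_Pow)
  qed
  have "\<not> has_mass_dimension B 0"
  proof
    assume "has_mass_dimension B 0"
    then have "(\<lambda>n. ln (real (card (B \<inter> {..<10 ^ n}))) / real n) \<longlonglongrightarrow> 0"
      using has_mass_dimension_powersD[of 10 B 0] B0 by auto
    \<comment> \<open>The lower bound is known along odd exponents, and this subsequence already
      contradicts the limit 0.\<close>
    moreover have "filterlim (\<lambda>n. 2 * n + 1 :: nat) at_top sequentially"
      by (intro filterlim_subseq) (simp add: strict_mono_def)
    ultimately have "(\<lambda>n. ln (real (card (B \<inter> {..<10 ^ (2 * n + 1)}))) / real (2 * n + 1)) \<longlonglongrightarrow> 0"
      by (rule filterlim_compose)
    then have "ln 2 / 3 \<le> (0::real)"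
    proof (rule LIMSEQ_le_const, intro exI allI impI)
      fix n :: nat assume n: "n \<ge> 1"
      have "ln (real (2 ^ n)) \<le> ln (real (card (B \<inter> {..<10 ^ (2 * n + 1)})))"
        by (rule ln_real_mono_nat[OF lower])
      then have "real n * ln 2 \<le> ln (real (card (B \<inter> {..<10 ^ (2 * n + 1)})))"
        by (simp add: ln_realpow)
      then have "real n * ln 2 / real (2 * n + 1) \<le> ln (real (card (B \<inter> {..<10 ^ (2 * n + 1)}))) / real (2 * n + 1)"
        by (rule divide_right_mono) simp
      \<comment> \<open>The quotient \<open>n / (2 * n + 1)\<close> is smallest at
        \<open>n = 1\<close>, where it equals 1/3.\<close>
      moreover have "ln 2 / 3 \<le> real n * ln 2 / real (2 * n + 1)"
        using n by (simp add: field_simps)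
      ultimately show "ln 2 / 3 \<le> ln (real (card (B \<inter> {..<10 ^ (2 * n + 1)}))) / real (2 * n + 1)"
        by (rule order_trans[rotated])
    qed
    then show False by simp
  qed
  moreover have "\<not> has_mass_dimension B (h / ln (real 10))"
  proof
    assume "has_mass_dimension B (h / ln (real 10))"
    then have "(\<lambda>n. ln (real (card (B \<inter> {..<10 ^ n}))) / real n) \<longlonglongrightarrow> h / ln (real 10) * ln (real 10)"
      using has_mass_dimension_powersD[of 10 B "h / ln (real 10)"] B0 by auto
    then have "(\<lambda>n. ln (real (card (B \<inter> {..<10 ^ n}))) / real n) \<longlonglongrightarrow> h"
      by simp
    moreover have "(\<lambda>n. ln (real (n + 2)) / real n + ln 6) \<longlonglongrightarrow> 0 + ln 6"
      by (intro tendsto_add tendsto_const) real_asymp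
    ultimately have "h \<le> 0 + ln 6"
    proof (rule LIMSEQ_le, intro exI allI impI)
      fix n :: nat assume n: "n \<ge> 1"
      have "ln (real (card (B \<inter> {..<10 ^ n}))) \<le> ln (real ((n + 2) * 6 ^ n))"
        by (rule ln_real_mono_nat[OF upper])
      also have "\<dots> = ln (real (n + 2)) + real n * ln 6"
        unfolding of_nat_mult by (subst ln_mult) (simp_all add: ln_realpow)
      finally show "ln (real (card (B \<inter> {..<10 ^ n}))) / real n \<le> ln (real (n + 2)) / real n + ln 6"
        using n by (simp add: field_simps)
    qed
    with h_ge have "ln 9 \<le> ln (6::real)" by linarith
    then show False by simp
  qed
  ultimately show ?thesis
    using P has_mass_dimension_shift_numbers[OF h] unfolding B_def by auto
qed

text \<open>If no member of \<open>S\<close> agrees with \<open>x\<close> on the first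
  \<open>n\<close> coordinates, the cylinder of these coordinates is an open neighbourhood of
  \<open>x\<close> missing \<open>S\<close>.\<close>

lemma closedin_sequences:
  assumes digits: "\<And>x i. x \<in> S \<Longrightarrow> x i < g"
    and limits: "\<And>x. (\<And>i. x i < g) \<Longrightarrow> (\<And>n. \<exists>y\<in>S. \<forall>i<n. y i = x i) \<Longrightarrow> x \<in> S"
  shows "closedin (product_topology (\<lambda>_. discrete_topology {..<g}) (UNIV :: nat set)) S"
proof -
  let ?T = "PiE (UNIV :: nat set) (\<lambda>_. {..<g})"
  have "openin (product_topology (\<lambda>_. discrete_topology {..<g}) UNIV) (?T - S)"
    unfolding openin_product_topology_alt
  proof
    fix x assume x: "x \<in> ?T - S"
    then have dx: "x i < g" for i by (auto simp: PiE_iff)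
    obtain n where n: "\<not> (\<exists>y\<in>S. \<forall>i<n. y i = x i)"
      using limits[of x] dx x by blast
    define U where "U i = (if i < n then {x i} else {..<g})" for i
    have "{i. U i \<noteq> {..<g}} \<subseteq> {..<n}" by (auto simp: U_def)
    then have "finite {i. U i \<noteq> {..<g}}" by (rule finite_subset) simp
    moreover have "U i \<subseteq> {..<g}" "x i \<in> U i" for i using dx by (auto simp: U_def)
    moreover have "PiE UNIV U \<subseteq> ?T - S"
    proof
      fix y assume y: "y \<in> PiE UNIV U"
      then have U: "y i \<in> U i" for i by (auto simp: PiE_iff)
      have "y i < g" for i using U[of i] \<open>U i \<subseteq> {..<g}\<close> by blast
      moreover have "y i = x i" if "i < n" for i using U[of i] that by (simp add: U_def)
      ultimately show "y \<in> ?T - S" using n by (auto simp: PiE_iff)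
    qed
    ultimately show "\<exists>U. finite {i \<in> UNIV. U i \<noteq> topspace (discrete_topology {..<g})} \<and>
        (\<forall>i\<in>UNIV. openin (discrete_topology {..<g}) (U i)) \<and> x \<in> PiE UNIV U \<and> PiE UNIV U \<subseteq> ?T - S"
      by (intro exI[of _ U]) (auto simp: PiE_iff)
  qed
  moreover have "S \<subseteq> ?T" using digits by (auto simp: PiE_iff)
  ultimately show ?thesis by (simp add: closedin_def)
qed

section \<open>The sofic example\<close>

text \<open>A union of two full shifts: the larger one, with entropy \<open>ln 9\<close>, avoids 0,
  so one occurrence of 0 confines the whole sequence to binary digits.\<close>

definition two_block_shift :: "(nat \<Rightarrow> nat) set" where
  "two_block_shift = {x. \<forall>i. x i \<in> {0, 1}} \<union> {x. \<forall>i. x i \<in> {1..9}}"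

lemma two_block_shift_zero:
  assumes "x \<in> two_block_shift" "x i = 0"
  shows "x j \<in> {0, 1}"
proof -
  have "\<not> (\<forall>i. x i \<in> {1..9})" using assms(2) by (auto intro!: exI[of _ i])
  then show ?thesis using assms(1) unfolding two_block_shift_def by blast
qed

lemma subshift_two_block_shift: "subshift 10 two_block_shift"
  unfolding subshift_def
proof (intro conjI)
  show "two_block_shift \<noteq> {}"
    unfolding two_block_shift_def by auto
  show "left_shift ` two_block_shift \<subseteq> two_block_shift"
  proof
    fix y assume "y \<in> left_shift ` two_block_shift"
    then obtain x where "x \<in> two_block_shift" and y: "y = (\<lambda>n. x (Suc n))"
      unfolding left_shift_def by blast
    then consider "\<forall>i. x i \<in> {0, 1}" | "\<forall>i. x i \<in> {1..9}"
      unfolding two_block_shift_def by blast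
    then show "y \<in> two_block_shift"
      by cases (simp_all add: y two_block_shift_def)
  qed
  show "closedin (product_topology (\<lambda>_. discrete_topology {..<10}) UNIV) two_block_shift"
  proof (rule closedin_sequences)
    fix x :: "nat \<Rightarrow> nat"
    assume dig: "\<And>i. x i < 10" and lim: "\<And>n. \<exists>y\<in>two_block_shift. \<forall>i<n. y i = x i"
    show "x \<in> two_block_shift"
    proof (cases "\<exists>i. x i = 0")
      case True
      then obtain i where i: "x i = 0" by blast
      have "x k \<in> {0, 1}" for k
      proof -
        \<comment> \<open>The agreement must reach both \<open>i\<close> and \<open>k\<close>, so
          that a single \<open>y\<close> has the zero and the digit in question.\<close>
        obtain y where y: "y \<in> two_block_shift" "\<forall>j<Suc (max i k). y j = x j"
          using lim by blast
        then have "y i = 0" "y k = x k" using i by simp_all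
        then show ?thesis using two_block_shift_zero[OF y(1), of i k] by simp
      qed
      then show ?thesis by (simp add: two_block_shift_def)
    next
      case False
      then have "x i \<in> {1..9}" for i
        using dig[of i] by (auto simp: Suc_le_eq less_Suc_eq_le numeral_eq_Suc)
      then show ?thesis by (simp add: two_block_shift_def)
    qed
  next
    fix x i assume "x \<in> two_block_shift"
    then have "x i \<in> {0, 1} \<or> x i \<in> {1..9}" unfolding two_block_shift_def by blast
    then show "x i < 10" by auto
  qed
qed

text \<open>The graph has two vertices and only loops: arcs 0 and 1 at vertex 0 are labelled by
  themselves, arcs 2 to 10 at vertex 1 by the digits 1 to 9. A path never leaves its first
  vertex.\<close>

lemma sofic_two_block_shift: "sofic two_block_shift"
proof -
  define v :: "nat \<Rightarrow> nat" where "v a = (if a < 2 then 0 else 1)" for a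
  define lab :: "nat \<Rightarrow> nat" where "lab a = (if a < 2 then a else a - 1)" for a
  define G where "G = \<lparr>verts = {0, 1}, arcs = {..10}, tail = v, head = v\<rparr>"
  have "fin_digraph G"
    by unfold_locales (auto simp: G_def v_def)
  moreover have "two_block_shift = label_sequences G lab"
  proof (intro equalityI subsetI)
    fix x assume "x \<in> two_block_shift"
    then consider "\<forall>i. x i \<in> {0, 1}" | "\<forall>i. x i \<in> {1..9}"
      unfolding two_block_shift_def by blast
    then show "x \<in> label_sequences G lab"
    proof cases
      case 1
      then have "x i = 0 \<or> x i = 1" for i by blast
      then have lt: "x i < 2" for i by (metis less_2_cases_iff One_nat_def)
      have le: "x i \<le> 10" for i using lt[of i] by linarith
      have "\<forall>n. x n \<in> arcs G \<and> head G (x n) = tail G (x (Suc n))" "x = (\<lambda>n. lab (x n))"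
        using lt le by (simp_all add: G_def v_def lab_def)
      then show ?thesis unfolding label_sequences_def by blast
    next
      case 2
      have range: "1 \<le> x i" "x i \<le> 9" for i using 2 by simp_all
      have arc: "v (Suc a) = 1" "lab (Suc a) = a" if "1 \<le> a" for a
        using that by (simp_all add: v_def lab_def)
      have "\<forall>n. Suc (x n) \<in> arcs G \<and> head G (Suc (x n)) = tail G (Suc (x (Suc n)))"
        using range(2) by (simp add: G_def arc(1)[OF range(1)] le_SucI numeral_eq_Suc)
      moreover have "x = (\<lambda>n. lab (Suc (x n)))"
        by (simp only: arc(2)[OF range(1)])
      ultimately show ?thesis
        unfolding label_sequences_def by (intro CollectI exI[of _ "\<lambda>n. Suc (x n)"] conjI)
    qed
  next
    fix x assume "x \<in> label_sequences G lab"
    then obtain e where e: "\<forall>n. e n \<in> arcs G \<and> head G (e n) = tail G (e (Suc n))" "x = (\<lambda>n. lab (e n))"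
      by (auto simp: label_sequences_def)
    have vv: "v (e n) = v (e 0)" for n
      using e(1) by (induction n) (simp_all add: G_def)
    have le: "e n \<le> 10" for n using e(1) by (simp add: G_def)
    show "x \<in> two_block_shift"
    proof (cases "e 0 < 2")
      case True
      then have "e n < 2" for n using vv[of n] by (simp add: v_def split: if_splits)
      then have "x n \<in> {0, 1}" for n by (simp add: e(2) lab_def less_2_cases)
      then show ?thesis by (simp add: two_block_shift_def)
    next
      case False
      then have ge: "e n \<ge> 2" for n using vv[of n] by (simp add: v_def split: if_splits)
      have "x n \<in> {1..9}" for n
        using le[of n] ge[of n] by (simp add: e(2) lab_def) arith
      then show ?thesis by (simp add: two_block_shift_def)
    qed
  qed
  ultimately show ?thesis unfolding sofic_def by blast
qed

lemma card_two_block_words_zero: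
  "card {w \<in> words two_block_shift (Suc m). \<exists>v. w = 0 # v} \<le> 6 ^ Suc m"
proof -
  have "{w \<in> words two_block_shift (Suc m). \<exists>v. w = 0 # v} \<subseteq> {w. set w \<subseteq> {0, 1} \<and> length w = Suc m}"
    unfolding word_starting_with_zero
  proof
    fix w assume "w \<in> (\<lambda>x. map x [0..<Suc m]) ` {x \<in> two_block_shift. x 0 = 0}"
    then obtain x where x: "w = map x [0..<Suc m]" "x \<in> two_block_shift" "x 0 = 0" by blast
    have "x ` set [0..<Suc m] \<subseteq> {0, 1}" 
      by (rule image_subsetI) (rule two_block_shift_zero[OF x(2,3)])
    then show "w \<in> {w. set w \<subseteq> {0, 1} \<and> length w = Suc m}"
      unfolding x(1) by (simp del: upt_Suc)
  qed
  then have "card {w \<in> words two_block_shift (Suc m). \<exists>v. w = 0 # v} \<le> card {w. set w \<subseteq> {0, 1::nat} \<and> length w = Suc m}"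
    by (rule card_mono[rotated]) (simp add: finite_lists_length_eq)
  also have "\<dots> = 2 ^ Suc m"
    by (subst card_lists_length_eq) (simp_all add: numeral_2_eq_2)
  also have "\<dots> \<le> 6 ^ Suc m" by (intro power_mono) auto
  finally show ?thesis .
qed

section \<open>The transitive example\<close>

text \<open>The windows begin just after a zero and do not count it; the case \<open>n = 1\<close>
  already forces the next digit to be 1. Only finite windows are constrained, which makes the
  condition closed.\<close>

definition sparse_after_zero :: "(nat \<Rightarrow> nat) \<Rightarrow> bool" where
  "sparse_after_zero x \<longleftrightarrow> (\<forall>i n. x i = 0 \<longrightarrow> 2 * card {j. j < n \<and> x (i + Suc j) \<noteq> 1} \<le> n)"

definition sparse_shift :: "(nat \<Rightarrow> nat) set" where
  "sparse_shift = {x. (\<forall>i. x i < 10) \<and> sparse_after_zero x}"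

lemma sparse_shiftI:
  assumes "\<And>i. x i < 10" "\<And>i n. x i = 0 \<Longrightarrow> 2 * card {j. j < n \<and> x (i + Suc j) \<noteq> 1} \<le> n"
  shows "x \<in> sparse_shift"
  using assms by (simp add: sparse_shift_def sparse_after_zero_def)

lemma sparse_shift_less: "x \<in> sparse_shift \<Longrightarrow> x i < 10"
  by (simp add: sparse_shift_def)

lemma sparse_shift_count:
  "x \<in> sparse_shift \<Longrightarrow> x i = 0 \<Longrightarrow> 2 * card {j. j < n \<and> x (i + Suc j) \<noteq> 1} \<le> n"
  by (simp add: sparse_shift_def sparse_after_zero_def)

lemma sparse_shift_nonzero:
  assumes "\<And>i. x i \<in> {1..9}"
  shows "x \<in> sparse_shift"
proof (rule sparse_shiftI)
  show "x i < 10" for i using assms[of i] by simp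
  show "2 * card {j. j < n \<and> x (i + Suc j) \<noteq> 1} \<le> n" if "x i = 0" for i n
    using assms[of i] that by simp
qed

lemma subshift_sparse_shift: "subshift 10 sparse_shift"
  unfolding subshift_def
proof (intro conjI)
  show "sparse_shift \<noteq> {}"
    using sparse_shift_nonzero[of "\<lambda>_. 1"] by auto
  show "left_shift ` sparse_shift \<subseteq> sparse_shift"
  proof
    fix y assume "y \<in> left_shift ` sparse_shift"
    then obtain x where x: "x \<in> sparse_shift" "y = left_shift x" by blast
    show "y \<in> sparse_shift"
    proof (rule sparse_shiftI)
      show "y i < 10" for i using sparse_shift_less[OF x(1)] by (simp add: x(2) left_shift_def)
      show "2 * card {j. j < n \<and> y (i + Suc j) \<noteq> 1} \<le> n" if "y i = 0" for i n
        using sparse_shift_count[OF x(1), of "Suc i" n] that by (simp add: x(2) left_shift_def)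
    qed
  qed
  show "closedin (product_topology (\<lambda>_. discrete_topology {..<10}) UNIV) sparse_shift"
  proof (rule closedin_sequences)
    show "x i < 10" if "x \<in> sparse_shift" for x i
      using that by (rule sparse_shift_less)
  next
    fix x :: "nat \<Rightarrow> nat"
    assume dig: "\<And>i. x i < 10" and lim: "\<And>n. \<exists>y\<in>sparse_shift. \<forall>i<n. y i = x i"
    show "x \<in> sparse_shift"
    proof (rule sparse_shiftI[OF dig])
      fix i n assume "x i = 0"
      obtain y where y: "y \<in> sparse_shift" "\<forall>j<Suc (i + n). y j = x j" using lim by blast
      have "{j. j < n \<and> x (i + Suc j) \<noteq> 1} = {j. j < n \<and> y (i + Suc j) \<noteq> 1}"
        using y(2) by auto
      then show "2 * card {j. j < n \<and> x (i + Suc j) \<noteq> 1} \<le> n"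
        using sparse_shift_count[OF y(1), of i n] y(2) \<open>x i = 0\<close> by simp
    qed
  qed
qed

text \<open>A run of ones twice as long as both words together compensates for all their other digits.\<close>
lemma transitive_sparse_shift: "transitive_shift sparse_shift"
  unfolding transitive_shift_def
proof (intro ballI)
  fix u v :: "nat list" assume "u \<in> language sparse_shift" "v \<in> language sparse_shift"
  then obtain x y where x: "x \<in> sparse_shift" "\<forall>i<length u. x i = u ! i"
    and y: "y \<in> sparse_shift" "\<forall>i<length v. y i = v ! i"
    unfolding language_def by blast
  define N where "N = 2 * (length u + length v)"
  define k where "k = length u + N"
  \<comment> \<open>The sequence reads \<open>u\<close>, then \<open>N\<close> ones, then
    \<open>v\<close>, and ones forever after.\<close>
  define z where "z i = (if i < length u then x i else if k \<le> i \<and> i < k + length v then y (i - k) else 1)" for i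
  have z: "z \<in> sparse_shift"
  proof (rule sparse_shiftI)
    show "z i < 10" for i
      using sparse_shift_less[OF x(1)] sparse_shift_less[OF y(1)] by (simp add: z_def)
    fix i n assume zi: "z i = 0"
    show "2 * card {j. j < n \<and> z (i + Suc j) \<noteq> 1} \<le> n"
    proof (cases "i < length u")
      case True
      then have xi: "x i = 0" using zi by (simp add: z_def)
      show ?thesis
      proof (cases "n \<le> N")
        case True
        \<comment> \<open>A window of length at most \<open>N\<close> starting inside
          \<open>u\<close> ends before \<open>v\<close> begins, so its digits other than 1 come from
          \<open>u\<close>.\<close>
        have "{j. j < n \<and> z (i + Suc j) \<noteq> 1} \<subseteq> {j. j < n \<and> x (i + Suc j) \<noteq> 1}"
          using True \<open>i < length u\<close> by (auto simp: z_def k_def split: if_splits)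
        then have "card {j. j < n \<and> z (i + Suc j) \<noteq> 1} \<le> card {j. j < n \<and> x (i + Suc j) \<noteq> 1}"
          by (rule card_mono[rotated]) simp
        then show ?thesis
          using sparse_shift_count[OF x(1) xi, of n] by linarith
      next
        case False
        \<comment> \<open>A longer window may meet all of \<open>u\<close> and \<open>v\<close>, but
          its length exceeds twice their total length.\<close>
        have "(\<lambda>j. i + Suc j) ` {j. j < n \<and> z (i + Suc j) \<noteq> 1} \<subseteq> {..<length u} \<union> {k..<k + length v}"
          by (auto simp: z_def split: if_splits)
        then have "card ((\<lambda>j. i + Suc j) ` {j. j < n \<and> z (i + Suc j) \<noteq> 1}) \<le> card ({..<length u} \<union> {k..<k + length v})"
          by (rule card_mono[rotated]) simp
        also have "\<dots> \<le> length u + length v"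
          using card_Un_le[of "{..<length u}" "{k..<k + length v}"] by simp
        finally show ?thesis
          using False by (simp add: card_image inj_on_def N_def)
      qed
    next
      case False
      then have k: "k \<le> i" "i < k + length v" and yi: "y (i - k) = 0"
        using zi by (auto simp: z_def split: if_splits)
      \<comment> \<open>Beyond \<open>v\<close> there are only ones in \<open>z\<close>, so
        replacing \<open>y\<close> by \<open>z\<close> adds no digit other than 1.\<close>
      have "y ((i - k) + Suc j) \<noteq> 1" if "z (i + Suc j) \<noteq> 1" for j
        using that k(1) by (simp add: z_def k_def Suc_diff_le split: if_splits)
      then have "{j. j < n \<and> z (i + Suc j) \<noteq> 1} \<subseteq> {j. j < n \<and> y ((i - k) + Suc j) \<noteq> 1}"
        by auto
      then have "card {j. j < n \<and> z (i + Suc j) \<noteq> 1} \<le> card {j. j < n \<and> y ((i - k) + Suc j) \<noteq> 1}"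
        by (rule card_mono[rotated]) simp
      then show ?thesis
        using sparse_shift_count[OF y(1) yi, of n] by linarith
    qed
  qed
  define w :: "nat list" where "w = replicate N 1"
  have "w \<in> language sparse_shift"
    by (rule languageI[OF sparse_shift_nonzero[of "\<lambda>_. 1"]]) (simp_all add: w_def)
  moreover have "u @ w @ v \<in> language sparse_shift"
  proof (rule languageI[OF z])
    fix i assume i: "i < length (u @ w @ v)"
    consider "i < length u" | "length u \<le> i" "i < k" | "k \<le> i" "i < k + length v"
      using i by (auto simp: w_def k_def) linarith
    then show "z i = (u @ w @ v) ! i"
    proof cases
      case 1
      then show ?thesis using x(2) by (simp add: z_def nth_append)
    next
      case 2
      then have "i - length u < N" by (simp add: k_def)
      with 2 show ?thesis by (simp add: z_def nth_append w_def k_def)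
    next
      case 3
      then have "\<not> i - length u < N" "i - length u - N = i - k" "i - k < length v"
        by (auto simp: k_def)
      with 3 show ?thesis using y(2) by (simp add: z_def nth_append w_def k_def)
    qed
  qed
  ultimately show "\<exists>w\<in>language sparse_shift. u @ w @ v \<in> language sparse_shift" by blast
qed

text \<open>Zeros sit at even positions, so in a window after one of them digits other than 1 occur
  only at odd offsets \<open>j\<close>, of which there are \<open>n div 2\<close> below
  \<open>n\<close>.\<close>

lemma sparse_shift_alternating:
  assumes "\<And>i. odd i \<Longrightarrow> x i = 1" "\<And>i. x i \<le> 1"
  shows "x \<in> sparse_shift"
proof (rule sparse_shiftI)
  show "x i < 10" for i using assms(2)[of i] by linarith
  fix i n assume "x i = 0"
  then have "even i" using assms(1)[of i] by fastforce
  have "{j. j < n \<and> x (i + Suc j) \<noteq> 1} \<subseteq> (\<lambda>l. 2 * l + 1) ` {..<n div 2}"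
  proof
    fix j assume "j \<in> {j. j < n \<and> x (i + Suc j) \<noteq> 1}"
    then have "j < n" "odd j" using assms(1)[of "i + Suc j"] \<open>even i\<close> by auto
    then show "j \<in> (\<lambda>l. 2 * l + 1) ` {..<n div 2}" by (auto elim!: oddE)
  qed
  from surj_card_le[OF _ this] show "2 * card {j. j < n \<and> x (i + Suc j) \<noteq> 1} \<le> n"
    by simp
qed

section \<open>Counting words by weights\<close>

text \<open>Distributivity: expanding the power of the sum gives one product for each word.\<close>

lemma sum_prod_list_words:
  fixes f :: "'a \<Rightarrow> 'b :: comm_semiring_1"
  assumes "finite A"
  shows "(\<Sum>w | set w \<subseteq> A \<and> length w = n. prod_list (map f w)) = (\<Sum>a\<in>A. f a) ^ n"
proof (induction n)
  case 0
  have "{w. set w \<subseteq> A \<and> length w = 0} = {[]}" by auto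
  then show ?case by simp
next
  case (Suc n)
  let ?W = "{w. set w \<subseteq> A \<and> length w = n}"
  have inj: "inj_on (\<lambda>(w, a). a # w) (?W \<times> A)" by (auto simp: inj_on_def)
  have "(\<Sum>w | set w \<subseteq> A \<and> length w = Suc n. prod_list (map f w))
      = (\<Sum>(w, a)\<in>?W \<times> A. prod_list (map f w) * f a)"
    unfolding lists_length_Suc_eq sum.reindex[OF inj]
    by (rule sum.cong) (auto simp: mult.commute)
  also have "\<dots> = (\<Sum>w\<in>?W. prod_list (map f w)) * (\<Sum>a\<in>A. f a)"
    by (simp add: sum.cartesian_product[symmetric] sum_product)
  finally show ?case using Suc by (simp add: mult.commute)
qed

text \<open>Weighting the digit \<open>1\<close> by \<open>9\<close> gives total weight \<open>18 ^ n\<close>, while each of the words counted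
  here has weight at least \<open>9 ^ (n / 2)\<close>.\<close>
lemma card_words_mostly_ones:
  "card {w. set w \<subseteq> {..<10::nat} \<and> length w = n \<and> 2 * length (filter (\<lambda>a. a \<noteq> 1) w) \<le> n} \<le> 6 ^ n"
proof -
  define \<omega> :: "nat \<Rightarrow> nat" where "\<omega> a = (if a = 1 then 9 else 1)" for a
  define V where "V = {w. set w \<subseteq> {..<10::nat} \<and> length w = n \<and> 2 * length (filter (\<lambda>a. a \<noteq> 1) w) \<le> n}"
  have weight: "prod_list (map \<omega> w) = 9 ^ length (filter (\<lambda>a. a = 1) w)" for w
    by (induction w) (simp_all add: \<omega>_def)
  have heavy: "3 ^ n \<le> prod_list (map \<omega> w)" if "w \<in> V" for w
  proof -
    have "length (filter (\<lambda>a. a = 1) w) + length (filter (\<lambda>a. a \<noteq> 1) w) = n"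
      using that sum_length_filter_compl[of "\<lambda>a. a = 1" w] by (simp add: V_def)
    then have "n \<le> 2 * length (filter (\<lambda>a. a = 1) w)" using that by (simp add: V_def)
    then have "(3::nat) ^ n \<le> 3 ^ (2 * length (filter (\<lambda>a. a = 1) w))"
      by (intro power_increasing) auto
    then show ?thesis unfolding weight power_mult by simp
  qed
  have "card V * 3 ^ n = (\<Sum>w\<in>V. 3 ^ n)" by simp
  also have "\<dots> \<le> (\<Sum>w\<in>V. prod_list (map \<omega> w))"
    by (rule sum_mono) (rule heavy)
  also have "\<dots> \<le> (\<Sum>w | set w \<subseteq> {..<10} \<and> length w = n. prod_list (map \<omega> w))"
    by (rule sum_mono2) (auto simp: V_def finite_lists_length_eq)
  also have "\<dots> = (\<Sum>a<10. \<omega> a) ^ n"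
    by (simp add: sum_prod_list_words)
  \<comment> \<open>Nine digits of weight 1 and the digit 1 of weight 9.\<close>
  also have "(\<Sum>a<10. \<omega> a) = 18"
    by (simp add: \<omega>_def eval_nat_numeral)
  also have "(18::nat) ^ n = 6 ^ n * 3 ^ n"
    by (simp flip: power_mult_distrib)
  finally show ?thesis unfolding V_def by simp
qed

text \<open>The \<open>m\<close> digits after the leading 0 form one window, so at most half of them
  differ from 1 and the weighted count applies.\<close>

lemma card_sparse_words_zero:
  "card {w \<in> words sparse_shift (Suc m). \<exists>v. w = 0 # v} \<le> 6 ^ Suc m"
proof -
  define V where "V = {w. set w \<subseteq> {..<10::nat} \<and> length w = m \<and> 2 * length (filter (\<lambda>a. a \<noteq> 1) w) \<le> m}"
  have "{w \<in> words sparse_shift (Suc m). \<exists>v. w = 0 # v} \<subseteq> (#) 0 ` V"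
    unfolding word_starting_with_zero
  proof
    fix w assume "w \<in> (\<lambda>x. map x [0..<Suc m]) ` {x \<in> sparse_shift. x 0 = 0}"
    then obtain x where x: "w = map x [0..<Suc m]" "x \<in> sparse_shift" "x 0 = 0" by blast
    define v where "v = map (\<lambda>i. x (Suc i)) [0..<m]"
    have "w = 0 # v" unfolding x(1) map_upt_Suc v_def x(3) ..
    moreover have "length (filter (\<lambda>a. a \<noteq> 1) v) = card {j. j < m \<and> x (Suc j) \<noteq> 1}"
      unfolding length_filter_conv_card by (rule arg_cong[of _ _ card]) (auto simp: v_def)
    then have "v \<in> V"
      using sparse_shift_count[OF x(2,3), of m] sparse_shift_less[OF x(2)] by (auto simp: V_def v_def)
    ultimately show "w \<in> (#) 0 ` V" by blast
  qed
  moreover have "finite V"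
    by (rule finite_subset[OF _ finite_lists_length_eq[of "{..<10}" m]]) (auto simp: V_def)
  ultimately have "card {w \<in> words sparse_shift (Suc m). \<exists>v. w = 0 # v} \<le> card V"
    by (intro surj_card_le)
  also have "\<dots> \<le> 6 ^ m" unfolding V_def by (rule card_words_mostly_ones)
  also have "\<dots> \<le> 6 ^ Suc m" by simp
  finally show ?thesis .
qed

theorem theorem3:
  shows
   "(\<forall>(g::nat) A \<Sigma> P.
       g \<ge> 2 \<and> times_invariant g A \<and>
       subshift g \<Sigma> \<and> transitive_shift \<Sigma> \<and> sofic \<Sigma> \<and> A = shift_numbers g \<Sigma> \<and>
       infinite_arith_prog P \<longrightarrow>
       (\<exists>d. has_mass_dimension A d \<and>
            (has_mass_dimension (A \<inter> P) 0 \<or> has_mass_dimension (A \<inter> P) d))) \<and>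
    (\<exists>(g::nat) \<Sigma> P.
       g \<ge> 2 \<and> subshift g \<Sigma> \<and> transitive_shift \<Sigma> \<and> infinite_arith_prog P \<and>
       (\<exists>d. has_mass_dimension (shift_numbers g \<Sigma>) d \<and>
            \<not> (has_mass_dimension (shift_numbers g \<Sigma> \<inter> P) 0 \<or>
               has_mass_dimension (shift_numbers g \<Sigma> \<inter> P) d))) \<and>
    (\<exists>(g::nat) \<Sigma> P.
       g \<ge> 2 \<and> subshift g \<Sigma> \<and> sofic \<Sigma> \<and> infinite_arith_prog P \<and>
       (\<exists>d. has_mass_dimension (shift_numbers g \<Sigma>) d \<and>
            \<not> (has_mass_dimension (shift_numbers g \<Sigma> \<inter> P) 0 \<or>
               has_mass_dimension (shift_numbers g \<Sigma> \<inter> P) d)))"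
proof (intro conjI)
  show "\<forall>(g::nat) A \<Sigma> P.
       g \<ge> 2 \<and> times_invariant g A \<and>
       subshift g \<Sigma> \<and> transitive_shift \<Sigma> \<and> sofic \<Sigma> \<and> A = shift_numbers g \<Sigma> \<and>
       infinite_arith_prog P \<longrightarrow>
       (\<exists>d. has_mass_dimension A d \<and>
            (has_mass_dimension (A \<inter> P) 0 \<or> has_mass_dimension (A \<inter> P) d))"
  proof (intro allI impI, elim conjE)
    fix g :: nat and A \<Sigma> P
    assume "g \<ge> 2" "subshift g \<Sigma>" and \<Sigma>: "transitive_shift \<Sigma>" "sofic \<Sigma>"
      and A: "A = shift_numbers g \<Sigma>" and P: "infinite_arith_prog P"
    then interpret shift_space g \<Sigma> by unfold_locales
    show "\<exists>d. has_mass_dimension A d \<and> (has_mass_dimension (A \<inter> P) 0 \<or> has_mass_dimension (A \<inter> P) d)"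
      unfolding A using transitive_sofic_dimension_dichotomy[OF \<Sigma> P] by blast
  qed
next
  obtain P where "infinite_arith_prog P \<and> (\<exists>\<delta>. has_mass_dimension (shift_numbers 10 sparse_shift) \<delta> \<and>
    \<not> (has_mass_dimension (shift_numbers 10 sparse_shift \<inter> P) 0 \<or>
       has_mass_dimension (shift_numbers 10 sparse_shift \<inter> P) \<delta>))"
    using decimal_counterexample[OF subshift_sparse_shift sparse_shift_nonzero sparse_shift_alternating
        card_sparse_words_zero] by blast
  then show "\<exists>(g::nat) \<Sigma> P.
       g \<ge> 2 \<and> subshift g \<Sigma> \<and> transitive_shift \<Sigma> \<and> infinite_arith_prog P \<and>
       (\<exists>d. has_mass_dimension (shift_numbers g \<Sigma>) d \<and>
            \<not> (has_mass_dimension (shift_numbers g \<Sigma> \<inter> P) 0 \<or>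
               has_mass_dimension (shift_numbers g \<Sigma> \<inter> P) d))"
    by (intro exI[of _ 10] exI[of _ sparse_shift] exI[of _ P])
      (simp add: subshift_sparse_shift transitive_sparse_shift)
next
  have "x \<in> two_block_shift" if "\<And>i. x i \<in> {1..9}" for x
    using that by (simp add: two_block_shift_def)
  moreover have "x \<in> two_block_shift" if "\<And>i. x i \<le> 1" for x
    using that by (simp add: two_block_shift_def le_Suc_eq)
  ultimately obtain P where "infinite_arith_prog P \<and> (\<exists>\<delta>. has_mass_dimension (shift_numbers 10 two_block_shift) \<delta> \<and>
    \<not> (has_mass_dimension (shift_numbers 10 two_block_shift \<inter> P) 0 \<or>
       has_mass_dimension (shift_numbers 10 two_block_shift \<inter> P) \<delta>))"
    using decimal_counterexample[OF subshift_two_block_shift _ _ card_two_block_words_zero] by blast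
  then show "\<exists>(g::nat) \<Sigma> P.
       g \<ge> 2 \<and> subshift g \<Sigma> \<and> sofic \<Sigma> \<and> infinite_arith_prog P \<and>
       (\<exists>d. has_mass_dimension (shift_numbers g \<Sigma>) d \<and>
            \<not> (has_mass_dimension (shift_numbers g \<Sigma> \<inter> P) 0 \<or>
               has_mass_dimension (shift_numbers g \<Sigma> \<inter> P) d))"
    by (intro exI[of _ 10] exI[of _ two_block_shift] exI[of _ P])
      (simp add: subshift_two_block_shift sofic_two_block_shift)
qed

end
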